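(* For every $k\ge1$, $\mathsf{LHI}\text{-}\mathsf{TWT}^{k}\not\subseteq\mathsf{MTT}^{k-1}$: there is a composition of $k$ functions, each computed by a tree-walking tree transducer of linear height increase, that is not a composition of $k-1$ functions computed by total deterministic macro tree transducers. As a consequence, for every $k\ge1$ there is a function computed by a tree-to-tree Hennie machine that is not in $\mathsf{MTT}^{k-1}$.
   Context: Trees: ranked alphabets are finite sets with a rank function to $\mathbb{N}$; $T_\Sigma$ is the set of finite ordered $\Sigma$-labeled trees where a node labeled $\sigma$ has $\mathrm{rank}(\sigma)$ children (nodes are words over positive integers, root $\varepsilon$, $i$-th child of $u$ is $ui$); $T_\Sigma[Y]$ allows extra rank-$0$ leaves labeled in $Y$; $\mathrm{height}(t)$ is the maximal number of edges on a root-to-leaf path. A function has linear height increase if $\mathrm{height}(f(t))\le c\,\mathrm{height}(t)+d$ for constants $c,d$. $\mathsf{MTT}^{0}$ and compositions of zero functions are identities. Tree-to-tree Hennie machines: a uTHM is $(Q,M,\top,\Sigma,\Gamma,q_{init},\delta)$ with finite states $Q$, finite memory symbols $M\ni\top$, $q_{init}\in Q$, partial $\delta:Q\times\Sigma\times M\rightharpoonup T_\Gamma[Q\times M\times D]$, $D=\{\uparrow,1,..,\max\mathrm{rank}\Sigma\}$, leaves $(q',m',d)$ of $\delta(q,\sigma,m)$ having $d\in\{\uparrow,1,..,\mathrm{rank}\sigma\}$. Configurations on $t$ are $(u,q,\mu)$, $\mu:$ nodes$\to M$, initially $(\varepsilon,q_{init},\text{constant }\top)$; the step of $(u,q,\mu)$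 is $\delta(q,\mathrm{lab}_t(u),\mu(u))$ with each leaf $(q',m',d)$ replaced by $(ud,q',\mu[u\mapsto m'])$ ($ud$ the parent if $d=\uparrow$, else the $d$-th child; undefined if nonexistent). Confluent rewriting of configuration leaves by steps from the initial configuration yields the output in $T_\Gamma$, if any. A branch-outputting run is $C_0,..,C_n$ with $C_0$ initial and $C_{i+1}$ a leaf label of the step of $C_i$; a THM is a uTHM for which some $N$ bounds, for all inputs, runs and nodes $u$, the number of $i$ with $C_i$ positioned at $u$. Tree-walking tree transducers (TWT): the same kind of machine with a single memory symbol (so configurations are just a node and a state), whose transitions may additionally depend on whether the current node is the root and, if not, for which $i$ it is an $i$-th child; i.e.\ $\delta:Q\times\Sigma\times(\{\mathrm{root}\}\cup\{1,..,\max\mathrm{rank}\Sigma\})\rightharpoonup T_\Gamma[Q\times D]$, with the same output semantics. Macro tree transducers: with variables $x_i$, parameters $y_j$, a total deterministic MTT from $\Sigma$ to $\Gamma$ has a finite ranked set of states, an initial state of rank $0$, and for each $q,\sigma$ a right-hand side: a tree over $\Gamma\cup\{\langle q',x_i\rangle: i\le\mathrm{rank}\sigma\}$ ($\mathrm{rank}\langle q',x_i\rangle=\mathrm{rank}q'$) with leaves possibly in $\{y_1,..,y_{\mathrm{rank}q}\}$, for the rule $\langle q,\sigma(t_1,..,t_k)\rangle(s_1,..,s_r)\to$ RHS with $x_i:=t_i,y_j:=s_j$; the output on $t$ is the tree of $T_\Gamma$ reached by exhaustive outside-in rewriting from $\langle q_{init},t\rangle$. $\mathsf{MTT}^{j}$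 is the class of compositions of $j$ such functions. *)

theory Defs
  imports Main
begin

text \<open>A ranked symbol is a pair (name, rank); a ranked alphabet is a finite set of such pairs.
  Trees may have extra leaves Lf y (the set Y of T_Sigma[Y]).\<close>

type_synonym sym = "nat \<times> nat"

datatype 'y tr = Nd sym "'y tr list" | Lf 'y

definition rank :: "sym \<Rightarrow> nat" where "rank s = snd s"

definition ranked_alphabet :: "sym set \<Rightarrow> bool" where
  "ranked_alphabet S \<longleftrightarrow> finite S"

definition maxrank :: "sym set \<Rightarrow> nat" where
  "maxrank S = Max (insert 0 (rank ` S))"

fun wf :: "sym set \<Rightarrow> 'y set \<Rightarrow> 'y tr \<Rightarrow> bool" where
  "wf S Y (Nd s ts) = (s \<in> S \<and> length ts = rank s \<and> list_all (wf S Y) ts)"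
| "wf S Y (Lf y) = (y \<in> Y)"

definition T :: "sym set \<Rightarrow> nat tr set" where
  "T S = {t. wf S {} t}"

fun height :: "'y tr \<Rightarrow> nat" where
  "height (Nd s ts) = (if ts = [] then 0 else Suc (Max (set (map height ts))))"
| "height (Lf y) = 0"

text \<open>Nodes are words over positive integers; the i-th child of u is u @ [i].\<close>
fun subt :: "'y tr \<Rightarrow> nat list \<Rightarrow> 'y tr option" where
  "subt t [] = Some t"
| "subt (Nd s ts) (i # u) = (if 1 \<le> i \<and> i \<le> length ts then subt (ts ! (i - 1)) u else None)"
| "subt (Lf y) (i # u) = None"

definition lab :: "'y tr \<Rightarrow> nat list \<Rightarrow> sym option" where
  "lab t u = (case subt t u of Some (Nd s _) \<Rightarrow> Some s | _ \<Rightarrow> None)"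

datatype dir = Up | Down nat

definition move :: "'y tr \<Rightarrow> nat list \<Rightarrow> dir \<Rightarrow> nat list option" where
  "move t u d = (case d of
      Up \<Rightarrow> (if u = [] then None else Some (butlast u))
    | Down i \<Rightarrow> (if subt t (u @ [i]) \<noteq> None then Some (u @ [i]) else None))"

definition valid_dir :: "sym \<Rightarrow> dir \<Rightarrow> bool" where
  "valid_dir s d \<longleftrightarrow> d = Up \<or> (\<exists>i. d = Down i \<and> 1 \<le> i \<and> i \<le> rank s)"

section \<open>Generic semantics by confluent rewriting of configuration leaves\<close>

inductive rw :: "('c \<Rightarrow> 'c tr option) \<Rightarrow> 'c tr \<Rightarrow> 'c tr \<Rightarrow> bool" for st where
  leaf: "st c = Some r \<Longrightarrow> rw st (Lf c) r"
| inner: "i < length ts \<Longrightarrow> rw st (ts ! i) t' \<Longrightarrow> rw st (Nd s ts) (Nd s (ts[i := t']))"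

definition ground :: "'c tr \<Rightarrow> bool" where
  "ground s \<longleftrightarrow> set_tr s = {}"

definition rw_output :: "('c \<Rightarrow> 'c tr option) \<Rightarrow> 'c \<Rightarrow> nat tr option" where
  "rw_output st c0 =
     (if \<exists>s. (rw st)\<^sup>*\<^sup>* (Lf c0) s \<and> ground s
      then Some (map_tr (\<lambda>_. 0) (THE s. (rw st)\<^sup>*\<^sup>* (Lf c0) s \<and> ground s))
      else None)"

type_synonym tf = "nat tr \<Rightarrow> nat tr option"

type_synonym hconf = "nat list \<times> nat \<times> (nat list \<Rightarrow> nat)"

record uthm =
  hQ :: "nat set"
  hM :: "nat set"
  htop :: nat
  hSig :: "sym set"
  hGam :: "sym set"
  hq0 :: nat
  hdelta :: "nat \<Rightarrow> sym \<Rightarrow> nat \<Rightarrow> (nat \<times> nat \<times> dir) tr option"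

definition wf_uthm :: "uthm \<Rightarrow> bool" where
  "wf_uthm A \<longleftrightarrow> finite (hQ A) \<and> finite (hM A) \<and> htop A \<in> hM A \<and>
     ranked_alphabet (hSig A) \<and> ranked_alphabet (hGam A) \<and> hq0 A \<in> hQ A \<and>
     (\<forall>q s m r. hdelta A q s m = Some r \<longrightarrow>
        q \<in> hQ A \<and> s \<in> hSig A \<and> m \<in> hM A \<and>
        wf (hGam A) {(q', m', d). q' \<in> hQ A \<and> m' \<in> hM A \<and> valid_dir s d} r)"

definition thm_step :: "uthm \<Rightarrow> nat tr \<Rightarrow> hconf \<Rightarrow> hconf tr option" where
  "thm_step A t C = (case C of (u, q, \<mu>) \<Rightarrow>
     (case lab t u of None \<Rightarrow> None | Some s \<Rightarrow>
       (case hdelta A q s (\<mu> u) of None \<Rightarrow> None | Some r \<Rightarrow>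
         (if \<forall>(q', m', d) \<in> set_tr r. move t u d \<noteq> None
          then Some (map_tr (\<lambda>(q', m', d). (the (move t u d), q', \<mu>(u := m'))) r)
          else None))))"

definition thm_init :: "uthm \<Rightarrow> hconf" where
  "thm_init A = ([], hq0 A, \<lambda>_. htop A)"

definition uthm_fun :: "uthm \<Rightarrow> tf" where
  "uthm_fun A = (\<lambda>t. if t \<in> T (hSig A) then rw_output (thm_step A t) (thm_init A) else None)"

definition branch_run :: "uthm \<Rightarrow> nat tr \<Rightarrow> hconf list \<Rightarrow> bool" where
  "branch_run A t cs \<longleftrightarrow> cs \<noteq> [] \<and> hd cs = thm_init A \<and>
     (\<forall>i. Suc i < length cs \<longrightarrow>
        (\<exists>r. thm_step A t (cs ! i) = Some r \<and> cs ! Suc i \<in> set_tr r))"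

definition is_THM :: "uthm \<Rightarrow> bool" where
  "is_THM A \<longleftrightarrow> wf_uthm A \<and>
     (\<exists>N::nat. \<forall>t \<in> T (hSig A). \<forall>cs. branch_run A t cs \<longrightarrow>
        (\<forall>u. card {i. i < length cs \<and> fst (cs ! i) = u} \<le> N))"

definition THM_fun :: "tf \<Rightarrow> bool" where
  "THM_fun f \<longleftrightarrow> (\<exists>A. is_THM A \<and> f = uthm_fun A)"

record twt =
  wQ :: "nat set"
  wSig :: "sym set"
  wGam :: "sym set"
  wq0 :: nat
  wdelta :: "nat \<Rightarrow> sym \<Rightarrow> nat option \<Rightarrow> (nat \<times> dir) tr option"
    \<comment> \<open>third argument: None = root, Some i = the node is an i-th child\<close>

definition wf_twt :: "twt \<Rightarrow> bool" where
  "wf_twt W \<longleftrightarrow> finite (wQ W) \<and> ranked_alphabet (wSig W) \<and> ranked_alphabet (wGam W) \<and>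
     wq0 W \<in> wQ W \<and>
     (\<forall>q s c r. wdelta W q s c = Some r \<longrightarrow>
        q \<in> wQ W \<and> s \<in> wSig W \<and>
        (c = None \<or> (\<exists>i. c = Some i \<and> 1 \<le> i \<and> i \<le> maxrank (wSig W))) \<and>
        wf (wGam W) {(q', d). q' \<in> wQ W \<and> valid_dir s d} r)"

definition child_info :: "nat list \<Rightarrow> nat option" where
  "child_info u = (if u = [] then None else Some (last u))"

definition twt_step :: "twt \<Rightarrow> nat tr \<Rightarrow> (nat list \<times> nat) \<Rightarrow> (nat list \<times> nat) tr option" where
  "twt_step W t C = (case C of (u, q) \<Rightarrow>
     (case lab t u of None \<Rightarrow> None | Some s \<Rightarrow>
       (case wdelta W q s (child_info u) of None \<Rightarrow> None | Some r \<Rightarrow>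
         (if \<forall>(q', d) \<in> set_tr r. move t u d \<noteq> None
          then Some (map_tr (\<lambda>(q', d). (the (move t u d), q')) r)
          else None))))"

definition twt_fun :: "twt \<Rightarrow> tf" where
  "twt_fun W = (\<lambda>t. if t \<in> T (wSig W) then rw_output (twt_step W t) ([], wq0 W) else None)"

definition TWT_fun :: "tf \<Rightarrow> bool" where
  "TWT_fun f \<longleftrightarrow> (\<exists>W. wf_twt W \<and> f = twt_fun W)"

definition LHI :: "tf \<Rightarrow> bool" where
  "LHI f \<longleftrightarrow> (\<exists>c d :: nat. \<forall>t s. f t = Some s \<longrightarrow> height s \<le> c * height t + d)"

text \<open>Right-hand sides: RO g as = output symbol g; RC q' i as = \<langle>q', x_i\<rangle>(as); RY j = y_j.
  States are ranked symbols (name, rank).\<close>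
datatype rhs = RO sym "rhs list" | RC sym nat "rhs list" | RY nat

record mtt =
  mQ :: "sym set"
  mSig :: "sym set"
  mGam :: "sym set"
  mq0 :: sym
  mrules :: "sym \<Rightarrow> sym \<Rightarrow> rhs"

fun wf_rhs :: "sym set \<Rightarrow> sym set \<Rightarrow> nat \<Rightarrow> nat \<Rightarrow> rhs \<Rightarrow> bool" where
  "wf_rhs G Q k p (RO g as) = (g \<in> G \<and> length as = rank g \<and> list_all (wf_rhs G Q k p) as)"
| "wf_rhs G Q k p (RC q i as) = (q \<in> Q \<and> 1 \<le> i \<and> i \<le> k \<and> length as = rank q \<and>
      list_all (wf_rhs G Q k p) as)"
| "wf_rhs G Q k p (RY j) = (1 \<le> j \<and> j \<le> p)"

definition wf_mtt :: "mtt \<Rightarrow> bool" where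
  "wf_mtt M \<longleftrightarrow> finite (mQ M) \<and> ranked_alphabet (mSig M) \<and> ranked_alphabet (mGam M) \<and>
     mq0 M \<in> mQ M \<and> rank (mq0 M) = 0 \<and>
     (\<forall>q \<in> mQ M. \<forall>s \<in> mSig M. wf_rhs (mGam M) (mQ M) (rank s) (rank q) (mrules M q s))"

text \<open>Sentential forms: output symbols and calls \<langle>q, t\<rangle>(args) on input subtrees t.\<close>
datatype sf = SO sym "sf list" | SC sym "nat tr" "sf list"

fun inst :: "nat tr list \<Rightarrow> sf list \<Rightarrow> rhs \<Rightarrow> sf" where
  "inst ts ys (RO g as) = SO g (map (inst ts ys) as)"
| "inst ts ys (RC q i as) = SC q (ts ! (i - 1)) (map (inst ts ys) as)"
| "inst ts ys (RY j) = ys ! (j - 1)"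

text \<open>Outside-in rewriting: a call is rewritten only if it is not inside the arguments of another call.\<close>
inductive oi :: "(sym \<Rightarrow> sym \<Rightarrow> rhs) \<Rightarrow> sf \<Rightarrow> sf \<Rightarrow> bool" for R where
  call: "oi R (SC q (Nd s ts) ys) (inst ts ys (R q s))"
| out: "i < length xs \<Longrightarrow> oi R (xs ! i) x' \<Longrightarrow> oi R (SO g xs) (SO g (xs[i := x']))"

fun sf_ground :: "sf \<Rightarrow> bool" where
  "sf_ground (SO g xs) = list_all sf_ground xs"
| "sf_ground (SC q t xs) = False"

fun sf_to_tr :: "sf \<Rightarrow> nat tr" where
  "sf_to_tr (SO g xs) = Nd g (map sf_to_tr xs)"
| "sf_to_tr (SC q t xs) = Nd q []"

definition mtt_fun :: "mtt \<Rightarrow> tf" where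
  "mtt_fun M = (\<lambda>t. if t \<in> T (mSig M) \<and> (\<exists>s. (oi (mrules M))\<^sup>*\<^sup>* (SC (mq0 M) t []) s \<and> sf_ground s)
     then Some (sf_to_tr (THE s. (oi (mrules M))\<^sup>*\<^sup>* (SC (mq0 M) t []) s \<and> sf_ground s))
     else None)"

definition MTT_fun :: "tf \<Rightarrow> bool" where
  "MTT_fun f \<longleftrightarrow> (\<exists>M. wf_mtt M \<and> f = mtt_fun M)"

fun comp_chain :: "tf list \<Rightarrow> tf" where
  "comp_chain [] = Some"
| "comp_chain (f # fs) = (\<lambda>t. Option.bind (f t) (comp_chain fs))"

definition cpow :: "tf set \<Rightarrow> nat \<Rightarrow> tf set" where
  "cpow C j = (if j = 0 then {(\<lambda>t. if t \<in> T S then Some t else None) | S. ranked_alphabet S}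
               else {comp_chain fs | fs. length fs = j \<and> set fs \<subseteq> C})"

end

theory Submission
  imports Defs "HOL-Library.Sublist" "HOL-Library.Nat_Bijection"
begin

text \<open>Call a map from trees to strings streaming if it is computed bottom-up by a finite type and
  finitely many string registers, where each register at a node is a concatenation of letters and
  child registers chosen by the types of the children. If h is streaming, M is a macro tree
  transducer, and h (M t) has no infix with two letters of A that occurs at two positions, then
  erasing the letters outside A from h (M t) is again streaming in t: a parameter
  whose value contains two letters of A is used at most once, so every call yields boundedly many
  string pieces around its long parameters, while short parameter values are finite information.
  Hence every erasure step removes one transducer from a composition.

  The witnesses are compositions that decorate, at each stage, all letters of the previous output
  string with pairwise distinct strings over fresh letters: by the address of the leaf for
  tree-walking transducers, and by the content of the marked tape for Hennie machines. After all
  transducers have been removed, a streaming map would have to print below a fixed context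
  unboundedly many decorations that determine the context, although only
  finitely many register values are available there.\<close>


section \<open>Denotational semantics of macro tree transducers\<close>

text \<open>The threshold of two letters has two sides. A word with at most one letter of A erases
  to one of finitely many words, since A is finite. A word with two letters of A contains the
  complete decoration of the first one, and distinct decorations fix its position; so it cannot have
  been copied. Without this obstacle to copying, a transducer could use a parameter unboundedly
  often, and no finite set of registers could hold the pieces of output between the copies. Each
  erasure pays one stage of decoration for one transducer. With k stages against k - 1 transducers,
  one decorated string is left over, and pumping needs exactly this: its decorations must reveal how
  many copies of a context surround a subtree, while the register values at that subtree do not
  depend on this number. The Hennie machine starts from a single letter, so it spends one further
  stage on producing a long string that can be decorated.\<close>

primrec rhs_val :: "(sym \<Rightarrow> nat tr list \<Rightarrow> nat tr) list \<Rightarrow> nat tr list \<Rightarrow> rhs \<Rightarrow> nat tr" where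
  "rhs_val fs es (RO g as) = Nd g (map (rhs_val fs es) as)"
| "rhs_val fs es (RC q i as) = (fs ! (i - 1)) q (map (rhs_val fs es) as)"
| "rhs_val fs es (RY j) = es ! (j - 1)"

primrec mtt_val :: "(sym \<Rightarrow> sym \<Rightarrow> rhs) \<Rightarrow> nat tr \<Rightarrow> sym \<Rightarrow> nat tr list \<Rightarrow> nat tr" where
  "mtt_val R (Nd s ts) = (\<lambda>q es. rhs_val (map (mtt_val R) ts) es (R q s))"
| "mtt_val R (Lf y) = (\<lambda>q es. Lf y)"

primrec sf_val :: "(sym \<Rightarrow> sym \<Rightarrow> rhs) \<Rightarrow> sf \<Rightarrow> nat tr" where
  "sf_val R (SO g xs) = Nd g (map (sf_val R) xs)"
| "sf_val R (SC q t xs) = mtt_val R t q (map (sf_val R) xs)"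

fun wf_sf :: "mtt \<Rightarrow> sf \<Rightarrow> bool" where
  "wf_sf M (SO g xs) = list_all (wf_sf M) xs"
| "wf_sf M (SC q t xs) = (q \<in> mQ M \<and> t \<in> T (mSig M) \<and> length xs = rank q \<and> list_all (wf_sf M) xs)"

lemma Nd_in_T_iff: "Nd s ts \<in> T S \<longleftrightarrow> s \<in> S \<and> length ts = rank s \<and> set ts \<subseteq> T S"
  by (auto simp: T_def list_all_iff)

lemma wf_sf_inst:
  assumes "wf_rhs G (mQ M) (length ts) (length ys) x" "set ts \<subseteq> T (mSig M)" "list_all (wf_sf M) ys"
  shows "wf_sf M (inst ts ys x)"
  using assms by (induction x) (auto simp: list_all_iff Suc_le_eq nth_mem subset_iff)

lemma sf_val_inst:
  assumes "wf_rhs G Q (length ts) (length ys) x"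
  shows "sf_val R (inst ts ys x) = rhs_val (map (mtt_val R) ts) (map (sf_val R) ys) x"
  using assms
proof (induction x)
  case (RO g as)
  then show ?case by (auto simp: list_all_iff)
next
  case (RC q i as)
  then have "map (sf_val R) (map (inst ts ys) as) = map (rhs_val (map (mtt_val R) ts) (map (sf_val R) ys)) as"
    by (auto simp: list_all_iff)
  moreover have "i - 1 < length ts" using RC.prems by auto
  ultimately show ?case by (simp only: inst.simps sf_val.simps rhs_val.simps nth_map)
next
  case (RY j)
  then show ?case by auto
qed

lemma oi_preserves_val:
  assumes "wf_mtt M" "oi (mrules M) x y" "wf_sf M x"
  shows "wf_sf M y \<and> sf_val (mrules M) y = sf_val (mrules M) x"
  using assms(2,3)
proof (induction)
  case (call q s ts ys)
  then have "wf_rhs (mGam M) (mQ M) (length ts) (length ys) (mrules M q s)"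
    using assms(1) by (auto simp: wf_mtt_def Nd_in_T_iff)
  with call show ?case
    by (auto simp: sf_val_inst Nd_in_T_iff intro!: wf_sf_inst)
next
  case (out i xs x' g)
  then have "wf_sf M (xs ! i)" by (auto simp: list_all_iff)
  with out have "wf_sf M x'" "sf_val (mrules M) x' = sf_val (mrules M) (xs ! i)" by auto
  with out show ?case
    by (auto simp: list_all_iff map_update list_update_same_conv dest!: set_update_subset_insert[THEN subsetD])
qed

lemma oi_rtranclp_preserves_val:
  assumes "wf_mtt M" "(oi (mrules M))\<^sup>*\<^sup>* x y" "wf_sf M x"
  shows "wf_sf M y \<and> sf_val (mrules M) y = sf_val (mrules M) x"
  using assms(2,3) by (induction) (use oi_preserves_val[OF assms(1)] in auto)

lemma sf_val_ground: "sf_ground x \<Longrightarrow> sf_val R x = sf_to_tr x"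
  by (induction x) (auto simp: list_all_iff)

text \<open>Turns uniqueness of the output tree into uniqueness of the ground form, as the
  \<open>THE\<close> in \<open>mtt_fun\<close> requires.\<close>

lemma sf_to_tr_inj:
  assumes "sf_ground x" "sf_ground y" "sf_to_tr x = sf_to_tr y"
  shows "x = y"
  using assms
proof (induction x arbitrary: y)
  case (SO g xs)
  then obtain ys where y: "y = SO g ys" by (cases y) auto
  have "map sf_to_tr xs = map sf_to_tr ys" using SO.prems y by simp
  then have "xs = ys"
  proof (rule list.inj_map_strong[rotated])
    fix a b assume "a \<in> set xs" "b \<in> set ys" "sf_to_tr a = sf_to_tr b"
    then show "a = b" using SO.IH SO.prems y by (auto simp: list_all_iff)
  qed
  with y show ?case by simp
qed simp

text \<open>Rewriting preserves the denotation and a ground form denotes itself, so the output is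
  determined without a confluence or termination argument. The lower bound only starts from outputs
  that exist.\<close>

lemma mtt_fun_val:
  assumes "wf_mtt M" "mtt_fun M t = Some r"
  shows "t \<in> T (mSig M) \<and> r = mtt_val (mrules M) t (mq0 M) []"
proof -
  let ?P = "\<lambda>s. (oi (mrules M))\<^sup>*\<^sup>* (SC (mq0 M) t []) s \<and> sf_ground s"
  from assms(2) obtain s where t: "t \<in> T (mSig M)" and s: "?P s"
    and r: "r = sf_to_tr (THE s. ?P s)"
    by (auto simp: mtt_fun_def split: if_splits)
  have wf: "wf_sf M (SC (mq0 M) t [])" using assms(1) t by (auto simp: wf_mtt_def)
  have v: "sf_to_tr s' = mtt_val (mrules M) t (mq0 M) []" if "?P s'" for s'
    using oi_rtranclp_preserves_val[OF assms(1) _ wf, of s'] sf_val_ground[of s' "mrules M"] that by auto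
  have "(THE s. ?P s) = s"
    using s by (rule the_equality) (metis v s sf_to_tr_inj)
  with r v[OF s] t show ?thesis by simp
qed

section \<open>Repeated infixes\<close>

definition cnt :: "nat set \<Rightarrow> nat list \<Rightarrow> nat" where
  "cnt A w = length (filter (\<lambda>x. x \<in> A) w)"

definition dup :: "nat set \<Rightarrow> nat list \<Rightarrow> bool" where
  "dup A z \<longleftrightarrow> (\<exists>x1 x2 x3 x4 u. z = x1 @ u @ x2 \<and> z = x3 @ u @ x4 \<and> length x1 < length x3 \<and> 2 \<le> cnt A u)"

lemma cnt_simps [simp]:
  "cnt A [] = 0" "cnt A (x # w) = (if x \<in> A then Suc (cnt A w) else cnt A w)"
  "cnt A (v @ w) = cnt A v + cnt A w"
  by (auto simp: cnt_def)

lemma dup_sublist: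
  assumes "dup A z" "sublist z z'" shows "dup A z'"
proof -
  obtain a b where z': "z' = a @ z @ b" using assms(2) by (auto simp: sublist_def)
  obtain x1 x2 x3 x4 u where "z = x1 @ u @ x2" "z = x3 @ u @ x4" "length x1 < length x3" "2 \<le> cnt A u"
    using assms(1) unfolding dup_def by blast
  then have "z' = (a @ x1) @ u @ (x2 @ b)" "z' = (a @ x3) @ u @ (x4 @ b)" "length (a @ x1) < length (a @ x3)"
    using z' by auto
  with \<open>2 \<le> cnt A u\<close> show ?thesis unfolding dup_def by blast
qed

lemma first_two_letters:
  assumes "2 \<le> cnt A u"
  obtains u1 a d a' u2 where "u = u1 @ a # d @ a' # u2" "cnt A u1 = 0" "cnt A d = 0" "a \<in> A" "a' \<in> A"
proof -
  have split: "\<exists>u1 a u2. u = u1 @ a # u2 \<and> cnt A u1 = 0 \<and> a \<in> A" if "0 < cnt A u" for u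
  proof -
    have "\<exists>x\<in>set u. x \<in> A" using that by (auto simp: cnt_def filter_empty_conv)
    from split_list_first_prop[OF this] show ?thesis
      by (auto simp: cnt_def filter_empty_conv)
  qed
  obtain u1 a u' where 1: "u = u1 @ a # u'" "cnt A u1 = 0" "a \<in> A" using split[of u] assms by auto
  moreover obtain d a' u2 where "u' = d @ a' # u2" "cnt A d = 0" "a' \<in> A" using split[of u'] 1 assms by auto
  ultimately show thesis using that by blast
qed

definition decorate :: "(nat \<times> nat list) list \<Rightarrow> nat list" where
  "decorate its = concat (map (\<lambda>(x, d). x # d) its)"

locale decorated =
  fixes A :: "nat set" and its :: "(nat \<times> nat list) list"
  assumes letters: "\<And>x d. (x, d) \<in> set its \<Longrightarrow> x \<in> A \<and> set d \<inter> A = {}"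

lemma cnt_0_iff: "cnt A d = 0 \<longleftrightarrow> set d \<inter> A = {}"
  by (auto simp: cnt_def filter_empty_conv)

lemma filter_decorate:
  assumes "decorated A its"
  shows "filter (\<lambda>x. x \<in> A) (decorate its) = map fst its"
proof -
  interpret decorated A its by fact
  have "filter (\<lambda>x. x \<in> A) (x # d) = [x]" if "(x, d) \<in> set its" for x d
    using letters[OF that] by (auto simp: filter_empty_conv)
  then show ?thesis unfolding decorate_def by (induction its) auto
qed

lemma cnt_decorate: "decorated A its \<Longrightarrow> cnt A (decorate its) = length its"
  by (simp add: cnt_def filter_decorate)

text \<open>The closing letter \<open>a'\<close> guarantees that \<open>d\<close> is a whole
  decoration and not a truncated one. The number of letters of \<open>A\<close> to the left is the
  index of the item.\<close>

lemma decorate_item: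
  assumes "decorated A its" "decorate its = y1 @ a # d @ a' # y2"
    "a \<in> A" "a' \<in> A" "cnt A d = 0"
  shows "cnt A y1 < length its \<and> its ! cnt A y1 = (a, d)"
  using assms(1,2)
proof (induction its arbitrary: y1)
  case Nil
  then show ?case by (simp add: decorate_def)
next
  case (Cons it its)
  obtain x e where it: "it = (x, e)" by force
  interpret decorated A "it # its" by fact
  have xe: "x \<in> A" "set e \<inter> A = {}" using letters[of x e] it by auto
  have dec: "decorated A its" using letters by unfold_locales auto
  have eq: "x # e @ decorate its = y1 @ a # d @ a' # y2" using Cons.prems it by (simp add: decorate_def)
  show ?case
  proof (cases y1)
    case Nil
    have hd: "decorate its = [] \<or> hd (decorate its) \<in> A"
      using dec by (cases its) (auto simp: decorate_def decorated_def)
    from Nil eq have "e @ decorate its = d @ a' # y2" by simp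
    moreover have "set d \<inter> A = {}" using assms(5) cnt_0_iff by blast
    moreover have "hd us \<notin> A" if "set us \<inter> A = {}" "us \<noteq> []" for us using that hd_in_set by fastforce
    ultimately have "e = d"
      using hd xe(2) \<open>a' \<in> A\<close>
      by (auto simp: append_eq_append_conv2 append_eq_Cons_conv Cons_eq_append_conv hd_append
          Int_Un_distrib2 split: if_splits)
    with Nil eq it show ?thesis by simp
  next
    case (Cons y y1')
    with eq have y: "y = x" and eq': "e @ decorate its = y1' @ a # d @ a' # y2" by auto
    have "\<exists>y1''. y1' = e @ y1'' \<and> decorate its = y1'' @ a # d @ a' # y2"
      using eq' xe(2) \<open>a \<in> A\<close> by (auto simp: append_eq_append_conv2 append_eq_Cons_conv Cons_eq_append_conv)
    then obtain y1'' where y1': "y1' = e @ y1''" and eq'': "decorate its = y1'' @ a # d @ a' # y2" by blast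
    have "cnt A y1 = Suc (cnt A y1'')" using Cons y y1' xe cnt_0_iff[of A e] by simp
    with Cons.IH[OF dec eq''] show ?thesis by simp
  qed
qed

text \<open>Both occurrences show the same complete item, so distinctness gives them the same index.
  But the later occurrence lies behind the letter \<open>a\<close> of the earlier one, which makes
  its index larger.\<close>

lemma decorate_not_dup:
  assumes "decorated A its" "distinct (map snd its)"
  shows "\<not> dup A (decorate its)"
proof
  assume "dup A (decorate its)"
  then obtain x1 x2 x3 x4 u where z1: "decorate its = x1 @ u @ x2" and z2: "decorate its = x3 @ u @ x4"
    and len: "length x1 < length x3" and u: "2 \<le> cnt A u"
    unfolding dup_def by blast
  obtain u1 a d a' u2 where ud: "u = u1 @ a # d @ a' # u2" "cnt A u1 = 0" "cnt A d = 0" "a \<in> A" "a' \<in> A"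
    using first_two_letters[OF u] by metis
  have 1: "cnt A (x1 @ u1) < length its \<and> its ! cnt A (x1 @ u1) = (a, d)"
    by (rule decorate_item[OF assms(1) _ ud(4,5,3), of _ "u2 @ x2"]) (simp add: z1 ud(1))
  have 2: "cnt A (x3 @ u1) < length its \<and> its ! cnt A (x3 @ u1) = (a, d)"
    by (rule decorate_item[OF assms(1) _ ud(4,5,3), of _ "u2 @ x4"]) (simp add: z2 ud(1))
  have eqc: "cnt A (x1 @ u1) = cnt A (x3 @ u1)"
    using 1 2 assms(2) by (metis length_map nth_eq_iff_index_eq nth_map snd_conv)
  have "(x1 @ u1 @ [a]) @ (d @ a' # u2 @ x2) = (x3 @ u1) @ (a # d @ a' # u2 @ x4)"
    using z1 z2 ud(1) by simp
  then have "prefix (x1 @ u1 @ [a]) (x3 @ u1)"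
    by (rule prefix_length_prefix[OF prefixI prefixI, OF sym refl]) (use len in simp)
  then obtain v where "x3 @ u1 = (x1 @ u1 @ [a]) @ v" by (auto simp: prefix_def)
  then have "cnt A (x3 @ u1) > cnt A (x1 @ u1)" using \<open>a \<in> A\<close> by simp
  with eqc show False by simp
qed

text \<open>The bound on \<open>r\<close> keeps the item away from the end of the list by the number
  of letters in \<open>u\<close>; this excludes the irregular last items of the comb trees
  below.\<close>

lemma decorate_sublist_item:
  assumes "decorated A its" "sublist u (decorate its)"
    and u: "u = u1 @ a # d @ a' # u2" "cnt A u1 = 0" "cnt A d = 0" "a \<in> A" "a' \<in> A"
  shows "\<exists>r. r + cnt A u \<le> length its \<and> its ! r = (a, d)"
proof -
  obtain x1 x2 where z: "decorate its = x1 @ u @ x2" using assms(2) by (auto simp: sublist_def)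
  have "cnt A (x1 @ u1) < length its \<and> its ! cnt A (x1 @ u1) = (a, d)"
    by (rule decorate_item[OF assms(1) _ u(4,5,3), of _ "u2 @ x2"]) (simp add: z u(1))
  moreover have "cnt A x1 + cnt A u \<le> length its"
    using cnt_decorate[OF assms(1)] z by simp
  ultimately show ?thesis using u(2) by auto
qed


section \<open>Streaming tree-to-string systems\<close>

text \<open>\<open>Inl a\<close> prints a letter, \<open>Inr (i, p)\<close> inserts register
  \<open>p\<close> of child \<open>i\<close>. Registers may be copied freely.\<close>

type_synonym 'p tmpl = "(nat + nat \<times> 'p) list"

definition fill :: "(nat \<Rightarrow> 'p \<Rightarrow> nat list) \<Rightarrow> 'p tmpl \<Rightarrow> nat list" where
  "fill f tm = concat (map (case_sum (\<lambda>a. [a]) (\<lambda>(i, p). f i p)) tm)"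

lemma fill_simps [simp]:
  "fill f [] = []" "fill f (Inl a # tm) = a # fill f tm" "fill f (Inr (i, p) # tm) = f i p @ fill f tm"
  "fill f (tm @ tm') = fill f tm @ fill f tm'"
  by (auto simp: fill_def)

text \<open>Children are referenced by 0-based positions.\<close>

locale string_system =
  fixes P :: "'p set" and ty :: "nat tr \<Rightarrow> 'c" and W :: "'p \<Rightarrow> nat tr \<Rightarrow> nat list"
    and ty_step :: "sym \<Rightarrow> 'c list \<Rightarrow> 'c" and tmpl :: "sym \<Rightarrow> 'c list \<Rightarrow> 'p \<Rightarrow> 'p tmpl"
  assumes finite_P: "finite P" and finite_ty: "finite (range ty)"
    and ty_Nd: "ty (Nd s ts) = ty_step s (map ty ts)"
    and W_Nd: "p \<in> P \<Longrightarrow> W p (Nd s ts) = fill (\<lambda>i p'. W p' (ts ! i)) (tmpl s (map ty ts) p)"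
    and tmpl_valid: "p \<in> P \<Longrightarrow> Inr (i, p') \<in> set (tmpl s (map ty ts) p) \<Longrightarrow> i < length ts \<and> p' \<in> P"

text \<open>Registers and types are coded as \<open>nat\<close> because a definition in HOL cannot
  quantify over types; \<open>streaming_W\<close> transfers any finite system to this form.\<close>

definition streaming :: "(nat tr \<Rightarrow> nat list) \<Rightarrow> bool" where
  "streaming h \<longleftrightarrow> (\<exists>(P :: nat set) (ty :: nat tr \<Rightarrow> nat) W ty_step tmpl.
     string_system P ty W ty_step tmpl \<and> (\<exists>p\<in>P. h = W p))"

lemma (in string_system) streaming_W:
  assumes "p \<in> P"
  shows "streaming (W p)"
proof -
  obtain f :: "'p \<Rightarrow> nat" where f: "inj_on f P" using finite_imp_inj_to_nat_seg[OF finite_P] by blast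
  obtain g :: "'c \<Rightarrow> nat" where g: "inj_on g (range ty)"
    using finite_imp_inj_to_nat_seg[OF finite_ty] by blast
  define f' where "f' = inv_into P f"
  define g' where "g' = inv_into (range ty) g"
  have f': "f' (f p) = p" if "p \<in> P" for p using that f by (simp add: f'_def)
  have g': "map g' (map (\<lambda>t. g (ty t)) ts) = map ty ts" for ts
    using g by (auto simp: g'_def intro!: inv_into_f_f)
  have "string_system (f ` P) (\<lambda>t. g (ty t)) (\<lambda>n. W (f' n)) (\<lambda>s cs. g (ty_step s (map g' cs)))
    (\<lambda>s cs n. map (map_sum id (map_prod id f)) (tmpl s (map g' cs) (f' n)))"
  proof (unfold_locales, goal_cases)
    case 1
    then show ?case using finite_P by simp
  next
    case 2
    then show ?case using finite_imageI[OF finite_ty, of g] by (simp add: image_image)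
  next
    case (3 s ts)
    then show ?case unfolding g' by (simp add: ty_Nd)
  next
    case (4 n s ts)
    then obtain p where p: "p \<in> P" "n = f p" by blast
    have "fill (\<lambda>i p'. W p' (ts ! i)) tm =
        fill (\<lambda>i n. W (f' n) (ts ! i)) (map (map_sum id (map_prod id f)) tm)"
      if "\<forall>i p'. Inr (i, p') \<in> set tm \<longrightarrow> p' \<in> P" for tm
      using that
    proof (induction tm)
      case (Cons x tm)
      then show ?case by (cases x) (auto simp: f')
    qed simp
    then show ?case using p tmpl_valid[OF p(1)] unfolding g' by (simp add: f' W_Nd)
  next
    case (5 n i m s ts)
    then obtain p where p: "p \<in> P" "n = f p" by blast
    then show ?case using 5(2) tmpl_valid[OF p(1), of _ _ s ts] unfolding g'
      by (auto simp: f' map_sum_def split: sum.splits)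
  qed
  then show ?thesis
    unfolding streaming_def using assms f' by (metis (mono_tags, lifting) image_eqI ext)
qed

primrec yield :: "'y tr \<Rightarrow> nat list" where
  "yield (Nd s ts) = (if ts = [] then [fst s] else concat (map yield ts))"
| "yield (Lf y) = []"

lemma streaming_yield: "streaming yield"
proof -
  interpret string_system "{()}" "\<lambda>_. ()" "\<lambda>_. yield" "\<lambda>_ _. ()"
    "\<lambda>s cs _. if cs = [] then [Inl (fst s)] else map (\<lambda>i. Inr (i, ())) [0..<length cs]"
  proof
    fix p s and ts :: "nat tr list"
    have "fill (\<lambda>i _. yield (ts ! i)) (map (\<lambda>i. Inr (i, ())) [0..<length ts]) = concat (map yield ts)"
      unfolding fill_def by (simp add: o_def) (metis map_nth map_map[unfolded o_def])
    then show "yield (Nd s ts) = fill (\<lambda>i _. yield (ts ! i))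
      (if map (\<lambda>_. ()) ts = [] then [Inl (fst s)] else map (\<lambda>i. Inr (i, ())) [0..<length (map (\<lambda>_. ()) ts)])"
      by auto
  qed (auto split: if_splits)
  show ?thesis by (rule streaming_W[of "()"]) simp
qed

subsection \<open>Pumping\<close>

text \<open>The printed letters and the registers of the fixed siblings contribute boundedly many
  letters. A large count must therefore come from one of the boundedly many occurrences of registers
  of the subtree in the hole.\<close>

lemma (in string_system) pump_step:
  assumes "p \<in> P"
  shows "\<exists>B. \<forall>s N. cnt A (W p (Nd g (pre @ s # post))) > B * (N + 1) \<longrightarrow>
    (\<exists>p'\<in>P. sublist (W p' s) (W p (Nd g (pre @ s # post))) \<and> cnt A (W p' s) > N)"
proof -
  define F where "F s = (\<lambda>i p'. W p' ((pre @ s # post) ! i))" for s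
  have tm: "\<exists>B. \<forall>s N. (\<forall>i p'. Inr (i, p') \<in> set tm \<longrightarrow> i < length pre + Suc (length post) \<and> p' \<in> P) \<longrightarrow>
     cnt A (fill (F s) tm) > B * (N + 1) \<longrightarrow>
    (\<exists>p'\<in>P. sublist (W p' s) (fill (F s) tm) \<and> cnt A (W p' s) > N)" for tm :: "'p tmpl"
  proof (induction tm)
    case Nil
    then show ?case by auto
  next
    case (Cons x tm)
    then obtain B where B: "\<And>s N. (\<forall>i p'. Inr (i, p') \<in> set tm \<longrightarrow> i < length pre + Suc (length post) \<and> p' \<in> P) \<Longrightarrow>
     cnt A (fill (F s) tm) > B * (N + 1) \<Longrightarrow>
    (\<exists>p'\<in>P. sublist (W p' s) (fill (F s) tm) \<and> cnt A (W p' s) > N)" by blast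
    \<comment> \<open>The weight of one template item: a letter counts once, a register of the hole
      costs at most \<open>N\<close> unless it is the one sought, and a sibling register has a fixed
      cost. \<open>undefined\<close> fills the hole, which is not consulted in the last
      case.\<close>
    define K where "K = (case x of Inl a \<Rightarrow> 1 | Inr (i, p') \<Rightarrow>
      if i = length pre then 1 else cnt A (W p' ((pre @ undefined # post) ! i)))"
    show ?case
    proof (intro exI[of _ "B + K"] allI impI, goal_cases)
      case (1 s N)
      have v: "\<forall>i p'. Inr (i, p') \<in> set tm \<longrightarrow> i < length pre + Suc (length post) \<and> p' \<in> P" using 1 by simp
      have fx: "fill (F s) (x # tm) = fill (F s) [x] @ fill (F s) tm"
        using fill_simps(4)[of "F s" "[x]" tm] by simp
      show ?case
      proof (cases "cnt A (fill (F s) tm) > B * (N + 1)")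
        case True
        from B[OF v True] obtain p' where "p' \<in> P" "sublist (W p' s) (fill (F s) tm)" "cnt A (W p' s) > N"
          by blast
        moreover have "sublist (fill (F s) tm) (fill (F s) [x] @ fill (F s) tm)" by (rule sublist_append_leftI)
        ultimately show ?thesis unfolding fx using sublist_order.order.trans by blast
      next
        case False
        then have c: "cnt A (fill (F s) [x]) > K * (N + 1)"
          using 1(2) unfolding fx by (simp add: algebra_simps)
        show ?thesis
        proof (cases x)
          case (Inl a)
          then show ?thesis using c by (auto simp: K_def split: if_splits)
        next
          case (Inr ip)
          obtain i p' where ip: "ip = (i, p')" by force
          show ?thesis
          proof (cases "i = length pre")
            case True
            then have "p' \<in> P" "N < cnt A (W p' s)" "fill (F s) [x] = W p' s"
              using c 1 Inr ip by (auto simp: K_def F_def)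
            then show ?thesis unfolding fx by (auto intro!: bexI[of _ p'])
          next
            case False
            then have "(pre @ s # post) ! i = (pre @ undefined # post) ! i"
              by (auto simp: nth_append nth_Cons split: nat.splits)
            then show ?thesis using False c Inr ip by (simp add: K_def F_def)
          qed
        qed
      qed
    qed
  qed
  define tmc where "tmc c = tmpl g (map ty pre @ c # map ty post) p" for c
  from tm obtain B where B: "\<And>tm s N. (\<forall>i p'. Inr (i, p') \<in> set tm \<longrightarrow> i < length pre + Suc (length post) \<and> p' \<in> P) \<Longrightarrow>
     cnt A (fill (F s) tm) > B tm * (N + 1) \<Longrightarrow>
    (\<exists>p'\<in>P. sublist (W p' s) (fill (F s) tm) \<and> cnt A (W p' s) > N)" by metis
  \<comment> \<open>The template depends on \<open>s\<close> only through its type, so summing over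
    the finitely many types gives a bound uniform in \<open>s\<close>.\<close>
  show ?thesis
  proof (intro exI[of _ "\<Sum>c\<in>range ty. B (tmc c)"] allI impI)
    fix s N
    assume "cnt A (W p (Nd g (pre @ s # post))) > (\<Sum>c\<in>range ty. B (tmc c)) * (N + 1)"
    moreover have W: "W p (Nd g (pre @ s # post)) = fill (F s) (tmc (ty s))"
      by (simp add: W_Nd[OF assms] tmc_def F_def)
    moreover have "B (tmc (ty s)) \<le> (\<Sum>c\<in>range ty. B (tmc c))"
      by (rule member_le_sum) (auto simp: finite_ty)
    ultimately have c: "cnt A (fill (F s) (tmc (ty s))) > B (tmc (ty s)) * (N + 1)"
      using le_less_trans[OF mult_le_mono1] by metis
    have "\<forall>i p'. Inr (i, p') \<in> set (tmc (ty s)) \<longrightarrow> i < length pre + Suc (length post) \<and> p' \<in> P"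
      using tmpl_valid[OF assms, of _ _ g "pre @ s # post"] by (auto simp: tmc_def)
    from B[OF this c] show "\<exists>p'\<in>P. sublist (W p' s) (W p (Nd g (pre @ s # post))) \<and> cnt A (W p' s) > N"
      unfolding W .
  qed
qed

text \<open>The order of quantifiers matters: the bound depends on the number of context copies, but
  not on the tree in the hole, which can be chosen afterwards.\<close>

lemma (in string_system) pump_iterate:
  assumes C: "\<And>s. C s = Nd g (pre @ s # post)"
  shows "p \<in> P \<Longrightarrow> \<exists>B. \<forall>s N. cnt A (W p ((C ^^ i) s)) > B * (N + 1) \<longrightarrow>
    (\<exists>p'\<in>P. sublist (W p' s) (W p ((C ^^ i) s)) \<and> cnt A (W p' s) > N)"
proof (induction i arbitrary: p)
  case 0
  then show ?case by (intro exI[of _ 1]) auto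
next
  case (Suc i)
  from pump_step[OF Suc.prems, of A g pre post] obtain B where B: "\<And>s N. cnt A (W p (C s)) > B * (N + 1) \<Longrightarrow>
    (\<exists>p'\<in>P. sublist (W p' s) (W p (C s)) \<and> cnt A (W p' s) > N)" unfolding C by blast
  from Suc.IH have "\<forall>p\<in>P. \<exists>B. \<forall>s N. cnt A (W p ((C ^^ i) s)) > B * (N + 1) \<longrightarrow>
    (\<exists>p'\<in>P. sublist (W p' s) (W p ((C ^^ i) s)) \<and> cnt A (W p' s) > N)" by blast
  then obtain D where D: "\<And>p s N. p \<in> P \<Longrightarrow> cnt A (W p ((C ^^ i) s)) > D p * (N + 1) \<Longrightarrow>
    (\<exists>p'\<in>P. sublist (W p' s) (W p ((C ^^ i) s)) \<and> cnt A (W p' s) > N)" by metis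
  define E where "E = (\<Sum>p\<in>P. D p)"
  show ?case
  proof (intro exI[of _ "B * (E + 1)"] allI impI)
    fix s N
    assume a: "cnt A (W p ((C ^^ Suc i) s)) > B * (E + 1) * (N + 1)"
    have "B * (E * (N + 1) + 1) \<le> B * (E + 1) * (N + 1)" by (simp add: algebra_simps)
    with a have "cnt A (W p (C ((C ^^ i) s))) > B * (E * (N + 1) + 1)" by (simp del: mult_Suc)
    from B[OF this] obtain q where q: "q \<in> P" "sublist (W q ((C ^^ i) s)) (W p (C ((C ^^ i) s)))"
      "cnt A (W q ((C ^^ i) s)) > E * (N + 1)" by blast
    have "D q \<le> E" unfolding E_def by (rule member_le_sum) (auto simp: finite_P q(1))
    with q(3) have "cnt A (W q ((C ^^ i) s)) > D q * (N + 1)"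
      using le_less_trans[OF mult_le_mono1] by metis
    from D[OF q(1) this] q(2) show "\<exists>p'\<in>P. sublist (W p' s) (W p ((C ^^ Suc i) s)) \<and> cnt A (W p' s) > N"
      by (auto intro: sublist_order.order.trans)
  qed
qed

text \<open>Pigeonhole: under each context some register of the same tree \<open>S m\<close> carries
  more than \<open>N\<close> letters into the output. Two contexts share such a register, and its
  value is an infix of both outputs although it should identify the context.\<close>

lemma not_streaming_if_context_visible:
  assumes "streaming h" and C: "\<And>s. C s = Nd g (pre @ s # post)"
    and many: "\<And>i m. m \<le> cnt A (h ((C ^^ i) (S m)))"
    and visible: "\<And>I. \<exists>N. \<forall>i\<le>I. \<forall>i'\<le>I. \<forall>m u. sublist u (h ((C ^^ i) (S m))) \<longrightarrow>
       sublist u (h ((C ^^ i') (S m))) \<longrightarrow> cnt A u > N \<longrightarrow> i = i'"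
  shows False
proof -
  obtain P :: "nat set" and ty :: "nat tr \<Rightarrow> nat" and W ty_step tmpl p where
    sys: "string_system P ty W ty_step tmpl" and p: "p \<in> P" "h = W p"
    using assms(1) unfolding streaming_def by blast
  interpret string_system P ty W ty_step tmpl by fact
  \<comment> \<open>The contexts \<open>0, ..., I\<close> outnumber the registers by one.\<close>
  define I where "I = card P"
  obtain N where N: "\<And>i i' m u. i \<le> I \<Longrightarrow> i' \<le> I \<Longrightarrow> sublist u (h ((C ^^ i) (S m))) \<Longrightarrow>
       sublist u (h ((C ^^ i') (S m))) \<Longrightarrow> cnt A u > N \<Longrightarrow> i = i'" using visible by metis
  obtain B where B: "\<And>i s. cnt A (h ((C ^^ i) s)) > B i * (N + 1) \<Longrightarrow>
    (\<exists>p'\<in>P. sublist (W p' s) (h ((C ^^ i) s)) \<and> cnt A (W p' s) > N)"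
    using pump_iterate[OF C p(1), of A] p(2) by metis
  define m where "m = Suc ((\<Sum>i\<le>I. B i) * (N + 1))"
  have "\<exists>p'\<in>P. sublist (W p' (S m)) (h ((C ^^ i) (S m))) \<and> cnt A (W p' (S m)) > N" if "i \<le> I" for i
  proof (rule B)
    have "B i \<le> (\<Sum>i\<le>I. B i)" by (rule member_le_sum) (use that in auto)
    then have "B i * (N + 1) < m" unfolding m_def using le_imp_less_Suc mult_le_mono1 by blast
    from this many show "B i * (N + 1) < cnt A (h ((C ^^ i) (S m)))" by (rule less_le_trans)
  qed
  then obtain q where q: "\<And>i. i \<le> I \<Longrightarrow> q i \<in> P \<and> sublist (W (q i) (S m)) (h ((C ^^ i) (S m)))
     \<and> cnt A (W (q i) (S m)) > N" by metis
  have "inj_on q {..I}"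
    by (rule inj_onI) (metis N q atMost_iff)
  then have "card {..I} \<le> card P" by (rule card_inj_on_le) (use q finite_P in auto)
  then show False by (simp add: I_def)
qed


section \<open>Words with variables\<close>

definition lmap :: "('l \<Rightarrow> 'm list) \<Rightarrow> ('l + 'v) list \<Rightarrow> ('m + 'v) list" where
  "lmap h w = concat (map (case_sum (\<lambda>l. map Inl (h l)) (\<lambda>v. [Inr v])) w)"

definition vsub :: "('v \<Rightarrow> ('l + 'w) list) \<Rightarrow> ('l + 'v) list \<Rightarrow> ('l + 'w) list" where
  "vsub f w = concat (map (case_sum (\<lambda>l. [Inl l]) f) w)"

primrec vars :: "('l + 'v) list \<Rightarrow> 'v list" where
  "vars [] = []"
| "vars (x # w) = (case x of Inl l \<Rightarrow> vars w | Inr v \<Rightarrow> v # vars w)"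

text \<open>Piece \<open>n\<close> is the block of letters between the \<open>n\<close>-th variable
  and the next one. Piece \<open>0\<close> precedes all variables, so there is one more piece than
  variables.\<close>

fun piece :: "nat \<Rightarrow> ('l + 'v) list \<Rightarrow> 'l list" where
  "piece n [] = []"
| "piece 0 (Inl l # w) = l # piece 0 w"
| "piece 0 (Inr v # w) = []"
| "piece (Suc n) (Inl l # w) = piece (Suc n) w"
| "piece (Suc n) (Inr v # w) = piece n w"

primrec interleave :: "(nat \<Rightarrow> ('l + 'v) list) \<Rightarrow> 'v list \<Rightarrow> ('l + 'v) list" where
  "interleave f [] = f 0"
| "interleave f (v # vs) = f 0 @ Inr v # interleave (\<lambda>n. f (Suc n)) vs"

text \<open>Forces every word to be linear in the variables of \<open>S\<close>, which bounds the
  number of its pieces on all inputs. On words that are already linear it changes nothing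
  (\<open>keep_first_id\<close>).\<close>

fun keep_first :: "'v set \<Rightarrow> ('l + 'v) list \<Rightarrow> ('l + 'v) list" where
  "keep_first S [] = []"
| "keep_first S (Inl l # w) = Inl l # keep_first S w"
| "keep_first S (Inr v # w) = (if v \<in> S then Inr v # keep_first (S - {v}) w else keep_first S w)"

lemma lmap_simps [simp]:
  "lmap h [] = []" "lmap h (Inl l # w) = map Inl (h l) @ lmap h w" "lmap h (Inr v # w) = Inr v # lmap h w"
  "lmap h (w @ w') = lmap h w @ lmap h w'"
  by (auto simp: lmap_def)

lemma vsub_simps [simp]:
  "vsub f [] = []" "vsub f (Inl l # w) = Inl l # vsub f w" "vsub f (Inr v # w) = f v @ vsub f w"
  "vsub f (w @ w') = vsub f w @ vsub f w'"
  by (auto simp: vsub_def)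

lemma vsub_map_Inl [simp]: "vsub f (map Inl w) = map Inl w"
  by (induction w) auto

lemma in_vsub:
  "Inl x \<in> set (vsub f w) \<Longrightarrow> Inl x \<in> set w \<or> (\<exists>v. Inr v \<in> set w \<and> Inl x \<in> set (f v))"
proof (induction w)
  case (Cons y w)
  then show ?case by (cases y) auto
qed simp

lemma lmap_vsub: "lmap h (vsub f w) = vsub (\<lambda>v. lmap h (f v)) (lmap h w)"
proof (induction w)
  case (Cons x w)
  then show ?case by (cases x) auto
qed simp

lemma keep_first_map_Inl [simp]: "keep_first S (map Inl w @ w') = map Inl w @ keep_first S w'"
  by (induction w) auto

lemma lmap_keep_first: "lmap h (keep_first S w) = keep_first S (lmap h w)"
  by (induction S w rule: keep_first.induct) auto

lemma vars_append [simp]: "vars (w @ w') = vars w @ vars w'"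
  by (induction w) (auto split: sum.split)

lemma vars_map_Inl [simp]: "vars (map Inl w) = []"
  by (induction w) auto

lemma vars_lmap [simp]: "vars (lmap h w) = vars w"
proof (induction w)
  case (Cons x w)
  then show ?case by (cases x) auto
qed simp

lemma set_vars: "set (vars w) = {v. Inr v \<in> set w}"
proof (induction w)
  case (Cons x w)
  then show ?case by (cases x) auto
qed simp

lemma piece_map_Inl [simp]:
  "piece 0 (map Inl xs @ w) = xs @ piece 0 w" "piece (Suc n) (map Inl xs @ w) = piece (Suc n) w"
  by (induction xs) auto

lemma piece_lmap: "piece n (lmap h w) = concat (map h (piece n w))"
  by (induction n w rule: piece.induct) auto

lemma set_piece: "l \<in> set (piece n w) \<Longrightarrow> Inl l \<in> set w"
  by (induction n w rule: piece.induct) auto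

text \<open>The split behind the erased system: the sequence of variables is finite information and
  goes into the type, the blocks of letters go into registers.\<close>

lemma interleave_pieces: "interleave (\<lambda>n. map Inl (piece n w)) (vars w) = w"
proof (induction w)
  case (Cons x w)
  show ?case
  proof (cases x)
    case (Inl l)
    have "interleave (\<lambda>n. map Inl (piece n (Inl l # w))) (vars w) =
        Inl l # interleave (\<lambda>n. map Inl (piece n w)) (vars w)"
      by (cases "vars w") auto
    with Cons Inl show ?thesis by simp
  qed (use Cons in simp)
qed simp

lemma lmap_interleave: "lmap h (interleave f vs) = interleave (\<lambda>n. lmap h (f n)) vs"
  by (induction vs arbitrary: f) auto

lemma Inl_in_interleave:
  "Inl l \<in> set (interleave f vs) \<Longrightarrow> \<exists>n\<le>length vs. Inl l \<in> set (f n)"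
  by (induction vs arbitrary: f) (auto, metis Suc_le_mono)

lemma Inl_in_keep_first: "Inl l \<in> set (keep_first S w) \<Longrightarrow> Inl l \<in> set w"
  by (induction S w rule: keep_first.induct) (auto split: if_splits)

lemma vars_keep_first: "distinct (vars (keep_first S w)) \<and> set (vars (keep_first S w)) \<subseteq> S"
  by (induction S w rule: keep_first.induct) auto

lemma keep_first_id: "distinct (vars w) \<Longrightarrow> set (vars w) \<subseteq> S \<Longrightarrow> keep_first S w = w"
  by (induction S w rule: keep_first.induct) (auto simp: subset_Diff_insert)

lemma vars_split:
  assumes "vars w = a @ v # b"
  obtains w1 w2 where "w = w1 @ Inr v # w2" "vars w1 = a" "vars w2 = b"
proof -
  have "\<exists>w1 w2. w = w1 @ Inr v # w2 \<and> vars w1 = a \<and> vars w2 = b"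
    using assms
  proof (induction w arbitrary: a)
    case (Cons x w)
    show ?case
    proof (cases x)
      case (Inl l)
      with Cons.prems have "vars w = a @ v # b" by simp
      with Cons.IH obtain w1 w2 where "w = w1 @ Inr v # w2" "vars w1 = a" "vars w2 = b" by blast
      then show ?thesis using Inl by (intro exI[of _ "Inl l # w1"] exI[of _ w2]) auto
    next
      case (Inr v')
      show ?thesis
      proof (cases a)
        case Nil
        then show ?thesis using Inr Cons.prems by (intro exI[of _ "[]"] exI[of _ w]) auto
      next
        case (Cons a1 a')
        with Cons.prems Inr have "vars w = a' @ v # b" "v' = a1" by auto
        with Cons.IH obtain w1 w2 where "w = w1 @ Inr v # w2" "vars w1 = a'" "vars w2 = b" by blast
        then show ?thesis using Inr Cons \<open>v' = a1\<close> by (intro exI[of _ "Inr v' # w1"] exI[of _ w2]) auto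
      qed
    qed
  qed simp
  with that show thesis by blast
qed

section \<open>Short values\<close>

text \<open>\<open>None\<close> stands for a long word, with two letters of \<open>A\<close> or
  more; a short word is represented by its erasure.\<close>

definition short :: "nat set \<Rightarrow> nat list \<Rightarrow> nat list option" where
  "short A w = (let u = filter (\<lambda>x. x \<in> A) w in if length u \<le> 1 then Some u else None)"

definition short_concat :: "nat list option list \<Rightarrow> nat list option" where
  "short_concat os = (if None \<in> set os then None else
     let u = concat (map the os) in if length u \<le> 1 then Some u else None)"

lemma short_None_iff: "short A w = None \<longleftrightarrow> 2 \<le> cnt A w"
  by (auto simp: short_def cnt_def Let_def)

lemma short_SomeD: "short A w = Some u \<Longrightarrow> u = filter (\<lambda>x. x \<in> A) w \<and> cnt A w \<le> 1"
  by (auto simp: short_def cnt_def Let_def split: if_splits)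

lemma short_concat: "short A (concat ws) = short_concat (map (short A) ws)"
proof (cases "None \<in> set (map (short A) ws)")
  case True
  then obtain w where "w \<in> set ws" "2 \<le> cnt A w" by (auto simp: short_None_iff[symmetric])
  then have "2 \<le> cnt A (concat ws)" by (induction ws) auto
  then have "short A (concat ws) = None" by (simp add: short_None_iff)
  moreover have "short_concat (map (short A) ws) = None" using True by (auto simp: short_concat_def)
  ultimately show ?thesis by simp
next
  case False
  then have "\<forall>w\<in>set ws. short A w = Some (filter (\<lambda>x. x \<in> A) w)"
    by (auto simp: short_def Let_def)
  then have "concat (map the (map (short A) ws)) = filter (\<lambda>x. x \<in> A) (concat ws)"
    unfolding filter_concat map_map by (intro arg_cong[where f = concat] map_cong) auto
  then show ?thesis using False
    unfolding short_concat_def short_def[of A "concat ws"] by (simp only: Let_def if_False)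
qed

lemma finite_range_short: "finite A \<Longrightarrow> finite (range (short A))"
proof -
  assume "finite A"
  then have "finite (insert None (Some ` {u. set u \<subseteq> A \<and> length u \<le> 1}))"
    using finite_lists_length_le by auto
  then show ?thesis
    by (rule finite_subset[rotated]) (auto simp: short_def Let_def)
qed

text \<open>\<open>short\<close> of a concatenation is computable from \<open>short\<close> of the
  factors, so the short values of all registers can be carried in the type.\<close>

lemma (in string_system) refine_types:
  assumes "finite A"
  shows "\<exists>ty' st' tm'. string_system P (\<lambda>t. (ty t, ty' t)) W st' tm' \<and> (\<forall>p\<in>P. \<forall>t. ty' t p = short A (W p t))"
proof -
  define ty' where "ty' t = (\<lambda>p. if p \<in> P then short A (W p t) else None)" for t
  define st' where "st' s cs = (ty_step s (map fst cs), \<lambda>p. if p \<in> P then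
    short_concat (map (case_sum (\<lambda>a. short A [a]) (\<lambda>(i, p'). snd (cs ! i) p')) (tmpl s (map fst cs) p))
    else None)" for s and cs :: "('c \<times> ('p \<Rightarrow> nat list option)) list"
  define tm' where "tm' s cs = tmpl s (map fst cs)" for s and cs :: "('c \<times> ('p \<Rightarrow> nat list option)) list"
  have fin: "finite {f. \<forall>p. (p \<in> P \<longrightarrow> f p \<in> range (short A)) \<and> (p \<notin> P \<longrightarrow> f p = None)}"
    by (rule finite_set_of_finite_funs) (auto simp: finite_P finite_range_short assms)
  have o: "fst \<circ> (\<lambda>t. (ty t, ty' t)) = ty" by auto
  have "string_system P (\<lambda>t. (ty t, ty' t)) W st' tm'"
  proof (unfold_locales, goal_cases)
    case 1
    show ?case by (rule finite_P)
  next
    case 2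
    show ?case
      by (rule finite_subset[OF _ finite_cartesian_product[OF finite_ty fin]]) (auto simp: ty'_def)
  next
    case (3 s ts)
    have "short A (W p (Nd s ts)) = short_concat (map (case_sum (\<lambda>a. short A [a])
      (\<lambda>(i, p'). snd (map (\<lambda>t. (ty t, ty' t)) ts ! i) p')) (tmpl s (map ty ts) p))" if "p \<in> P" for p
      unfolding W_Nd[OF that] fill_def short_concat map_map
      by (intro arg_cong[where f = short_concat] map_cong)
        (auto split: sum.split simp: ty'_def dest!: tmpl_valid[OF that])
    then have "ty' (Nd s ts) = snd (st' s (map (\<lambda>t. (ty t, ty' t)) ts))"
      by (simp add: fun_eq_iff st'_def o ty'_def[of "Nd s ts"])
    moreover have "ty (Nd s ts) = fst (st' s (map (\<lambda>t. (ty t, ty' t)) ts))" by (simp add: st'_def o ty_Nd)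
    ultimately show ?case by (simp only: prod.collapse)
  next
    case (4 p s ts)
    then show ?case by (simp add: tm'_def o W_Nd)
  next
    case (5 p i p' s ts)
    then show ?case using tmpl_valid by (simp add: tm'_def o)
  qed
  then show ?thesis by (intro exI[of _ ty'] exI[of _ st'] exI[of _ tm']) (auto simp: ty'_def)
qed


section \<open>Erasing letters from the output of a macro tree transducer\<close>

locale erasing = string_system P ty W ty_step tmpl
  for P :: "'p set" and ty :: "nat tr \<Rightarrow> 'c" and W ty_step tmpl +
  fixes A :: "nat set" and sh :: "'c \<Rightarrow> 'p \<Rightarrow> nat list option" and M :: mtt
  assumes sh: "p \<in> P \<Longrightarrow> sh (ty t) p = short A (W p t)" and wf_M: "wf_mtt M"
begin

text \<open>Of the actual parameters a call sees only their types. These contain the short register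
  values; long values stay symbolic, as variables from \<open>params\<close>.\<close>

definition calls :: "(sym \<times> 'c list) set" where
  "calls = {(q, cs). q \<in> mQ M \<and> set cs \<subseteq> range ty \<and> length cs = rank q}"

definition params :: "(nat \<times> 'p) set" where
  "params = {1..maxrank (mQ M)} \<times> P"

definition look :: "('c \<times> ('p \<Rightarrow> ('l + nat \<times> 'p) list)) list \<Rightarrow> nat \<Rightarrow> 'p \<Rightarrow> ('l + nat \<times> 'p) list" where
  "look vs i p = (if i < length vs then snd (vs ! i) p else [])"

text \<open>The letter type is polymorphic: it is instantiated with output letters, and with
  template items for the evaluation that only knows the types of the children.\<close>

primrec ev :: "(nat \<Rightarrow> 'l) \<Rightarrow> (nat \<Rightarrow> sym \<Rightarrow> 'c list \<Rightarrow> 'c \<times> ('p \<Rightarrow> ('l + nat \<times> 'p) list))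
    \<Rightarrow> 'c list \<Rightarrow> rhs \<Rightarrow> 'c \<times> ('p \<Rightarrow> ('l + nat \<times> 'p) list)" where
  "ev emb ch cs (RO g as) = (ty_step g (map fst (map (ev emb ch cs) as)),
     \<lambda>p. concat (map (case_sum (\<lambda>a. if a \<in> A then [Inl (emb a)] else [])
         (\<lambda>(i, p'). look (map (ev emb ch cs) as) i p'))
       (tmpl g (map fst (map (ev emb ch cs) as)) p)))"
| "ev emb ch cs (RC q i as) = (fst (ch (i - 1) q (map fst (map (ev emb ch cs) as))),
     \<lambda>p. vsub (\<lambda>(j, p'). look (map (ev emb ch cs) as) (j - 1) p')
       (snd (ch (i - 1) q (map fst (map (ev emb ch cs) as))) p))"
| "ev emb ch cs (RY j) = (cs ! (j - 1),
     \<lambda>p. case sh (cs ! (j - 1)) p of None \<Rightarrow> [Inr (j, p)] | Some w \<Rightarrow> map (Inl \<circ> emb) w)"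

text \<open>Evaluation only moves letters around, so it commutes with replacing letters by words.
  This is the free theorem for the polymorphic letter type.\<close>

lemma ev_natural:
  fixes emb :: "nat \<Rightarrow> 'l" and emb' :: "nat \<Rightarrow> 'm"
  assumes emb: "\<And>a. h (emb a) = [emb' a]"
    and ch: "\<And>i q cs. ch' i q cs = map_prod id (\<lambda>f p. lmap h (f p)) (ch i q cs)"
  shows "ev emb' ch' cs x = map_prod id (\<lambda>f p. lmap h (f p)) (ev emb ch cs x)"
proof (induction x)
  case (RO g as)
  let ?vs = "map (ev emb ch cs) as" and ?vs' = "map (ev emb' ch' cs) as"
  have f: "map fst ?vs' = map fst ?vs" using RO by simp
  have l: "look ?vs' i p = lmap h (look ?vs i p)" for i p
    using RO by (auto simp: look_def)
  have "concat (map (case_sum (\<lambda>a. if a \<in> A then [Inl (emb' a)] else []) (\<lambda>(i, p'). look ?vs' i p')) tm) =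
    lmap h (concat (map (case_sum (\<lambda>a. if a \<in> A then [Inl (emb a)] else []) (\<lambda>(i, p'). look ?vs i p')) tm))" for tm
  proof (induction tm)
    case (Cons x tm)
    then show ?case by (cases x) (auto simp: l emb)
  qed simp
  then show ?case by (simp only: ev.simps f map_prod_simp id_apply)
next
  case (RC q i as)
  let ?vs = "map (ev emb ch cs) as" and ?vs' = "map (ev emb' ch' cs) as"
  have f: "map fst ?vs' = map fst ?vs" using RC by simp
  have l: "look ?vs' i p = lmap h (look ?vs i p)" for i p
    using RC by (auto simp: look_def)
  have "ch' (i - 1) q (map fst ?vs') = map_prod id (\<lambda>f p. lmap h (f p)) (ch (i - 1) q (map fst ?vs))"
    unfolding f by (rule ch)
  then show ?case
    by (simp only: ev.simps l lmap_vsub case_prod_unfold fst_map_prod snd_map_prod map_prod_simp id_apply)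
next
  case (RY j)
  have "(map (Inl \<circ> emb') w :: ('m + nat \<times> 'p) list) = lmap h (map (Inl \<circ> emb) w)" for w :: "nat list"
    by (induction w) (auto simp: emb)
  then show ?case by (auto split: option.split)
qed

text \<open>Traces every symbolic letter back to a child result; the validity of the templates
  \<open>ltmpl\<close> rests on this.\<close>

lemma ev_letters:
  fixes x :: 'l
  shows "Inl x \<in> set (snd (ev emb ch cs e) p) \<Longrightarrow>
    (\<exists>a. x = emb a) \<or> (\<exists>i q cs' p'. Inl x \<in> set (snd (ch i q cs') p'))"
proof (induction e arbitrary: p)
  case (RO g as)
  then obtain it where it: "Inl x \<in> set (case_sum (\<lambda>a. if a \<in> A then [Inl (emb a)] else [])
         (\<lambda>(i, p'). look (map (ev emb ch cs) as) i p') it)"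
    by (auto simp del: map_map)
  obtain a b where "x = emb a \<or> Inl x \<in> set (look (map (ev emb ch cs) as) a b)"
    using it by (cases it) (auto split: if_splits)
  moreover have "\<exists>e\<in>set as. Inl x \<in> set (snd (ev emb ch cs e) b)"
    if "Inl x \<in> set (look (map (ev emb ch cs) as) a b)"
    using that by (auto simp: look_def split: if_splits)
  ultimately show ?case using RO.IH by blast
next
  case (RC q i as)
  then obtain j p' where "Inl x \<in> set (snd (ch (i - 1) q (map fst (map (ev emb ch cs) as))) p)
      \<or> Inl x \<in> set (look (map (ev emb ch cs) as) j p')"
    using in_vsub by fastforce
  moreover have "\<exists>e\<in>set as. Inl x \<in> set (snd (ev emb ch cs e) p')"
    if "Inl x \<in> set (look (map (ev emb ch cs) as) j p')"
    using that by (auto simp: look_def split: if_splits)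
  ultimately show ?case using RC.IH by blast
next
  case (RY j)
  then show ?case by (auto split: option.splits)
qed

text \<open>Keeps computed types inside the finite set \<open>range ty\<close> even for ill-formed
  inputs, where \<open>mrules\<close> is unconstrained.\<close>

definition clamp :: "'c \<Rightarrow> 'c" where
  "clamp c = (if c \<in> range ty then c else ty (Lf 0))"

text \<open>Defaults for missing children, ill-formed calls and foreign registers, so that only
  finitely many registers are ever referenced.\<close>

definition restr :: "nat \<Rightarrow> (nat \<Rightarrow> sym \<Rightarrow> 'c list \<Rightarrow> 'c \<times> ('p \<Rightarrow> ('l + nat \<times> 'p) list)) \<Rightarrow>
    nat \<Rightarrow> sym \<Rightarrow> 'c list \<Rightarrow> 'c \<times> ('p \<Rightarrow> ('l + nat \<times> 'p) list)" where
  "restr n f i q cs = (if i < n \<and> (q, cs) \<in> calls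
     then (fst (f i q cs), \<lambda>p. if p \<in> P then snd (f i q cs) p else []) else (ty (Lf 0), \<lambda>_. []))"

text \<open>The erased meaning of a call at a subtree: the type of its result and, for each
  register, a linear word over letters of \<open>A\<close> and long parameter registers.\<close>

primrec lin :: "nat tr \<Rightarrow> sym \<Rightarrow> 'c list \<Rightarrow> 'c \<times> ('p \<Rightarrow> (nat + nat \<times> 'p) list)" where
  "lin (Nd s ts) = (\<lambda>q cs. let v = ev id (restr (length ts) (\<lambda>i. map lin ts ! i)) cs (mrules M q s)
     in (clamp (fst v), \<lambda>p. keep_first params (snd v p)))"
| "lin (Lf y) = (\<lambda>q cs. (ty (Lf 0), \<lambda>p. []))"

definition ltype :: "nat tr \<Rightarrow> sym \<times> 'c list \<Rightarrow> 'c \<times> ('p \<Rightarrow> (nat \<times> 'p) list)" where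
  "ltype t = (\<lambda>(q, cs). if (q, cs) \<in> calls
     then (fst (lin t q cs), \<lambda>p. if p \<in> P then vars (snd (lin t q cs) p) else [])
     else (ty (Lf 0), \<lambda>_. []))"

text \<open>A linear word has at most \<open>card params\<close> variables, hence at most
  \<open>card params + 1\<close> pieces; the bound on \<open>l\<close> is inclusive.\<close>

definition pieces :: "(sym \<times> 'c list \<times> 'p \<times> nat) set" where
  "pieces = {(q, cs, p, l). (q, cs) \<in> calls \<and> p \<in> P \<and> l \<le> card params}"

definition lW :: "sym \<times> 'c list \<times> 'p \<times> nat \<Rightarrow> nat tr \<Rightarrow> nat list" where
  "lW = (\<lambda>(q, cs, p, l) t. piece l (snd (lin t q cs) p))"

text \<open>Rebuilds the shape of \<open>lin\<close> from the type alone, with one symbolic letter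
  per piece. Evaluating over these letters produces the templates of the erased system.\<close>

definition symbolic :: "(sym \<times> 'c list \<Rightarrow> 'c \<times> ('p \<Rightarrow> (nat \<times> 'p) list)) list \<Rightarrow> nat \<Rightarrow> sym \<Rightarrow> 'c list \<Rightarrow>
    'c \<times> ('p \<Rightarrow> ((nat + nat \<times> sym \<times> 'c list \<times> 'p \<times> nat) + nat \<times> 'p) list)" where
  "symbolic ls i q cs = (fst ((ls ! i) (q, cs)),
     \<lambda>p. interleave (\<lambda>l. [Inl (Inr (i, q, cs, p, l))]) (snd ((ls ! i) (q, cs)) p))"

definition lsym where
  "lsym s ls q cs = ev Inl (restr (length ls) (symbolic ls)) cs (mrules M q s)"

definition lstep where
  "lstep s ls = (\<lambda>(q, cs). if (q, cs) \<in> calls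
     then (clamp (fst (lsym s ls q cs)),
       \<lambda>p. if p \<in> P then vars (keep_first params (snd (lsym s ls q cs) p)) else [])
     else (ty (Lf 0), \<lambda>_. []))"

definition ltmpl where
  "ltmpl s ls = (\<lambda>(q, cs, p, l). piece l (keep_first params (snd (lsym s ls q cs) p)))"

definition inst_item :: "nat tr list \<Rightarrow> nat + nat \<times> sym \<times> 'c list \<times> 'p \<times> nat \<Rightarrow> nat list" where
  "inst_item ts = case_sum (\<lambda>a. [a]) (\<lambda>(i, x). lW x (ts ! i))"

text \<open>Naturality for \<open>inst_item ts\<close> turns the symbolic evaluation, which knows
  only the types of the children, into the actual one.\<close>

lemma lin_Nd:
  "lin (Nd s ts) q cs = (clamp (fst (lsym s (map ltype ts) q cs)),
     \<lambda>p. lmap (inst_item ts) (keep_first params (snd (lsym s (map ltype ts) q cs) p)))"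
proof -
  have "restr (length ts) (\<lambda>i. map lin ts ! i) i q cs =
     map_prod id (\<lambda>f p. lmap (inst_item ts) (f p)) (restr (length (map ltype ts)) (symbolic (map ltype ts)) i q cs)"
    for i q cs
  proof (cases "i < length ts \<and> (q, cs) \<in> calls")
    case True
    have "lmap (inst_item ts) (interleave (\<lambda>l. [Inl (Inr (i, q, cs, p, l))]) (vars (snd (lin (ts ! i) q cs) p)))
      = snd (lin (ts ! i) q cs) p" for p
      by (simp add: lmap_interleave inst_item_def lW_def interleave_pieces)
    with True show ?thesis by (auto simp: restr_def symbolic_def ltype_def fun_eq_iff)
  qed (auto simp: restr_def fun_eq_iff)
  from ev_natural[where emb = Inl and emb' = id and h = "inst_item ts", OF _ this, where cs = cs and x = "mrules M q s"]
  have "ev id (restr (length ts) (\<lambda>i. map lin ts ! i)) cs (mrules M q s) =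
     map_prod id (\<lambda>f p. lmap (inst_item ts) (f p)) (lsym s (map ltype ts) q cs)"
    by (simp add: lsym_def inst_item_def)
  then show ?thesis by (simp add: lmap_keep_first Let_def)
qed

lemma finite_params: "finite params"
  by (simp add: params_def finite_P)

lemma finite_calls: "finite calls"
proof (rule finite_subset)
  show "calls \<subseteq> mQ M \<times> {cs. set cs \<subseteq> range ty \<and> length cs \<le> maxrank (mQ M)}"
    using wf_M by (auto simp: calls_def maxrank_def wf_mtt_def)
  show "finite (mQ M \<times> {cs. set cs \<subseteq> range ty \<and> length cs \<le> maxrank (mQ M)})"
    using wf_M finite_ty by (auto simp: wf_mtt_def intro!: finite_lists_length_le)
qed

lemma vars_lin: "distinct (vars (snd (lin t q cs) p)) \<and> set (vars (snd (lin t q cs) p)) \<subseteq> params"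
  by (cases t) (auto simp: Let_def vars_keep_first vars_keep_first[THEN conjunct2, THEN subsetD])

lemma length_vars_lin: "length (vars (snd (lin t q cs) p)) \<le> card params"
  using vars_lin[of t q cs p] card_mono[OF finite_params] by (metis distinct_card)

lemma finite_ltype: "finite (range ltype)"
proof -
  define V where "V = {vs. set vs \<subseteq> params \<and> length vs \<le> card params}"
  have V: "finite V" unfolding V_def by (rule finite_lists_length_le) (rule finite_params)
  define F where "F = {f :: 'p \<Rightarrow> _. \<forall>p. (p \<in> P \<longrightarrow> f p \<in> V) \<and> (p \<notin> P \<longrightarrow> f p = [])}"
  have F: "finite F" unfolding F_def by (rule finite_set_of_finite_funs) (use V finite_P in auto)
  have clamp: "fst (lin t q cs) \<in> range ty" for t q cs
    by (cases t) (auto simp: Let_def clamp_def)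
  have "range ltype \<subseteq> {f. \<forall>x. (x \<in> calls \<longrightarrow> f x \<in> range ty \<times> F) \<and> (x \<notin> calls \<longrightarrow> f x = (ty (Lf 0), \<lambda>_. []))}"
    using clamp vars_lin length_vars_lin by (auto simp: ltype_def F_def V_def)
  then show ?thesis
    by (rule finite_subset)
      (rule finite_set_of_finite_funs, rule finite_calls, use F finite_ty in auto)
qed

lemma finite_pieces: "finite pieces"
proof (rule finite_subset)
  show "pieces \<subseteq> (\<lambda>((q, cs), p, l). (q, cs, p, l)) ` (calls \<times> P \<times> {..card params})"
    by (force simp: pieces_def image_def)
qed (use finite_calls finite_P in auto)

sublocale erased: string_system pieces ltype lW lstep ltmpl
proof (unfold_locales, goal_cases)
  case 1
  show ?case by (rule finite_pieces)
next
  case 2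
  show ?case by (rule finite_ltype)
next
  case (3 s ts)
  show ?case unfolding ltype_def[of "Nd s ts"] lin_Nd lstep_def by (auto simp: fun_eq_iff)
next
  case (4 x s ts)
  obtain q cs p l where x: "x = (q, cs, p, l)" by (metis prod_cases4)
  show ?case unfolding x lW_def ltmpl_def prod.case lin_Nd snd_conv piece_lmap
    unfolding inst_item_def fill_def lW_def by simp
next
  case (5 x i y s ts)
  obtain q cs p l where x: "x = (q, cs, p, l)" by (metis prod_cases4)
  let ?ls = "map ltype ts"
  from 5(2) have "Inl (Inr (i, y)) \<in> set (keep_first params (snd (lsym s ?ls q cs) p))"
    by (auto simp: x ltmpl_def dest: set_piece)
  then have "Inl (Inr (i, y)) \<in> set (snd (lsym s ?ls q cs) p)" by (rule Inl_in_keep_first)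
  then obtain i' q' cs' p' where "Inl (Inr (i, y)) \<in> set (snd (restr (length ?ls) (symbolic ?ls) i' q' cs') p')"
    unfolding lsym_def by (auto dest!: ev_letters)
  then have c: "i' < length ts" "(q', cs') \<in> calls" "p' \<in> P"
    and "(Inl (Inr (i, y)) :: (nat + nat \<times> sym \<times> 'c list \<times> 'p \<times> nat) + nat \<times> 'p)
      \<in> set (interleave (\<lambda>l. [Inl (Inr (i', q', cs', p', l))]) (vars (snd (lin (ts ! i') q' cs') p')))"
    by (auto simp: restr_def symbolic_def ltype_def split: if_splits)
  then obtain l' where "l' \<le> length (vars (snd (lin (ts ! i') q' cs') p'))" "i = i'" "y = (q', cs', p', l')"
    by (auto dest!: Inl_in_interleave)
  with c show ?case by (auto simp: pieces_def intro: order_trans[OF _ length_vars_lin])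
qed

end


section \<open>Correctness of the erased system\<close>

context erasing
begin

text \<open>\<open>U\<close> records how a register value at a call is composed of printed letters
  and parameter registers. \<open>inst_vars\<close> restores the value; \<open>proj\<close> below
  erases it and resolves the short parameter registers.\<close>

definition inst_vars :: "nat tr list \<Rightarrow> (nat + nat \<times> 'p) list \<Rightarrow> nat list" where
  "inst_vars es U = concat (map (case_sum (\<lambda>a. [a]) (\<lambda>(j, p). W p (es ! (j - 1)))) U)"

definition proj :: "'c list \<Rightarrow> (nat + nat \<times> 'p) list \<Rightarrow> (nat + nat \<times> 'p) list" where
  "proj cs U = concat (map (case_sum (\<lambda>a. if a \<in> A then [Inl a] else [])
     (\<lambda>(j, p). case sh (cs ! (j - 1)) p of None \<Rightarrow> [Inr (j, p)] | Some w \<Rightarrow> map Inl w)) U)"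

definition valid :: "nat \<Rightarrow> (nat + nat \<times> 'p) list \<Rightarrow> bool" where
  "valid n U \<longleftrightarrow> (\<forall>j p. Inr (j, p) \<in> set U \<longrightarrow> 1 \<le> j \<and> j \<le> n \<and> p \<in> P)"

text \<open>A long parameter value that is used twice makes the output repeat an infix, so in the
  absence of repetitions the linearised word w is the erased word.\<close>

definition correct :: "nat tr list \<Rightarrow> nat list \<Rightarrow> (nat + nat \<times> 'p) list \<Rightarrow> bool" where
  "correct es z w \<longleftrightarrow> dup A z \<or>
     (\<exists>U. valid (length es) U \<and> z = inst_vars es U \<and> proj (map ty es) U = w)"

lemma inst_vars_simps [simp]:
  "inst_vars es [] = []" "inst_vars es (Inl a # U) = a # inst_vars es U"
  "inst_vars es (Inr (j, p) # U) = W p (es ! (j - 1)) @ inst_vars es U"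
  "inst_vars es (U @ U') = inst_vars es U @ inst_vars es U'"
  by (auto simp: inst_vars_def)

lemma proj_simps [simp]:
  "proj cs [] = []" "proj cs (Inl a # U) = (if a \<in> A then [Inl a] else []) @ proj cs U"
  "proj cs (Inr (j, p) # U) =
    (case sh (cs ! (j - 1)) p of None \<Rightarrow> [Inr (j, p)] | Some w \<Rightarrow> map Inl w) @ proj cs U"
  "proj cs (U @ U') = proj cs U @ proj cs U'"
  by (auto simp: proj_def)

lemma valid_simps [simp]:
  "valid n []" "valid n (Inl a # U) \<longleftrightarrow> valid n U"
  "valid n (Inr (j, p) # U) \<longleftrightarrow> 1 \<le> j \<and> j \<le> n \<and> p \<in> P \<and> valid n U"
  "valid n (U @ U') \<longleftrightarrow> valid n U \<and> valid n U'"
  by (auto simp: valid_def)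

lemma sh_nth:
  assumes "1 \<le> j" "j \<le> length es" "p \<in> P"
  shows "sh (map ty es ! (j - 1)) p = short A (W p (es ! (j - 1)))"
proof -
  have "j - 1 < length es" using assms by auto
  with assms(3) show ?thesis by (simp add: sh)
qed

text \<open>A short value contains only short parameter values, so its projection has no variables
  left. This makes reading a short value from the type agree with substituting for it.\<close>

lemma proj_short:
  assumes "valid (length es) U" "cnt A (inst_vars es U) \<le> 1"
  shows "proj (map ty es) U = map Inl (filter (\<lambda>x. x \<in> A) (inst_vars es U))"
  using assms
proof (induction U)
  case (Cons x U)
  show ?case
  proof (cases x)
    case (Inl a)
    with Cons show ?thesis by (auto split: if_splits)
  next
    case (Inr v)
    obtain j p where v: "v = (j, p)" by force
    with Inr Cons.prems have j: "1 \<le> j" "j \<le> length es" "p \<in> P" and U: "valid (length es) U" by auto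
    from Cons.prems Inr v have c: "cnt A (W p (es ! (j - 1))) \<le> 1" "cnt A (inst_vars es U) \<le> 1" by auto
    then obtain u where u: "short A (W p (es ! (j - 1))) = Some u"
      using short_None_iff[of A "W p (es ! (j - 1))"] by fastforce
    then have "u = filter (\<lambda>x. x \<in> A) (W p (es ! (j - 1)))" by (blast dest: short_SomeD)
    with Cons.IH[OF U c(2)] Inr v show ?thesis
      by (simp add: sh_nth[OF j, simplified] u[simplified])
  qed
qed simp

lemma vars_proj: "vars (proj cs U) = filter (\<lambda>(j, p). sh (cs ! (j - 1)) p = None) (vars U)"
proof (induction U)
  case (Cons x U)
  then show ?case by (cases x) (auto split: option.splits)
qed simp

lemma sublist_inst_vars:
  "Inr (j, p) \<in> set U \<Longrightarrow> sublist (W p (es ! (j - 1))) (inst_vars es U)"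
  by (auto dest!: split_list)

lemma filter_eq_split:
  assumes "filter Q l = xs @ v # ys"
  shows "\<exists>a b. l = a @ v # b \<and> filter Q b = ys"
  using assms
proof (induction l arbitrary: xs)
  case (Cons x l)
  show ?case
  proof (cases "xs = [] \<and> Q x")
    case True
    with Cons.prems show ?thesis by (intro exI[of _ "[]"] exI[of _ l]) simp
  next
    case False
    with Cons.prems have "\<exists>xs. filter Q l = xs @ v # ys"
      by (cases xs) (auto split: if_splits intro: exI[of _ "[]"])
    with Cons.IH obtain a b where "l = a @ v # b" "filter Q b = ys" by blast
    then show ?thesis by (intro exI[of _ "x # a"] exI[of _ b]) simp
  qed
qed simp

text \<open>A variable that survives projection has a value with two letters of \<open>A\<close>. If
  it survives twice, this nonempty value stands at two positions.\<close>

lemma not_distinct_dup: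
  assumes "valid (length es) U" "\<not> distinct (vars (proj (map ty es) U))"
  shows "dup A (inst_vars es U)"
proof -
  let ?L = "\<lambda>(j, p). sh (map ty es ! (j - 1)) p = None"
  obtain xs ys zs v where f: "filter ?L (vars U) = xs @ v # ys @ v # zs"
    using not_distinct_decomp[OF assms(2)] unfolding vars_proj by auto
  obtain us1 us2 where s1: "vars U = us1 @ v # us2" "filter ?L us2 = ys @ v # zs"
    using filter_eq_split[OF f] by metis
  obtain us3 us4 where s2: "us2 = us3 @ v # us4"
    using filter_eq_split[OF s1(2)] by metis
  have "v \<in> set (filter ?L (vars U))" using f by simp
  then obtain j p where v: "v = (j, p)" "sh (map ty es ! (j - 1)) p = None" by auto
  obtain U1 U' where 1: "U = U1 @ Inr v # U'" "vars U' = us2" using vars_split[OF s1(1)] by metis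
  obtain U2 U3 where 2: "U' = U2 @ Inr v # U3" using vars_split[of U' us3 v us4] 1(2) s2 by metis
  have j: "1 \<le> j" "j \<le> length es" "p \<in> P" using assms(1) 1 v by auto
  let ?u = "W p (es ! (j - 1))"
  have c: "2 \<le> cnt A ?u" using v(2) sh_nth[OF j] short_None_iff by metis
  then have "?u \<noteq> []" by auto
  have "inst_vars es U = inst_vars es U1 @ ?u @ (inst_vars es U2 @ ?u @ inst_vars es U3)"
    "inst_vars es U = (inst_vars es U1 @ ?u @ inst_vars es U2) @ ?u @ inst_vars es U3"
    unfolding 1 2 v(1) by simp_all
  moreover have "length (inst_vars es U1) < length (inst_vars es U1 @ ?u @ inst_vars es U2)"
    using \<open>?u \<noteq> []\<close> by simp
  ultimately show ?thesis using c unfolding dup_def by blast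
qed

lemma inst_vars_vsub:
  assumes "\<And>j p. Inr (j, p) \<in> set U \<Longrightarrow> inst_vars es (f (j, p)) = W p (es' ! (j - 1))"
  shows "inst_vars es (vsub f U) = inst_vars es' U"
  using assms
proof (induction U)
  case (Cons x U)
  then show ?case by (cases x) auto
qed simp

lemma valid_vsub:
  assumes "\<And>j p. Inr (j, p) \<in> set U \<Longrightarrow> valid n (f (j, p))"
  shows "valid n (vsub f U)"
  using assms
proof (induction U)
  case (Cons x U)
  then show ?case by (cases x) auto
qed simp

lemma proj_vsub:
  assumes "\<And>j p. Inr (j, p) \<in> set U \<Longrightarrow> sh (cs' ! (j - 1)) p = None \<Longrightarrow> g (j, p) = proj cs (f (j, p))"
    and "\<And>j p w. Inr (j, p) \<in> set U \<Longrightarrow> sh (cs' ! (j - 1)) p = Some w \<Longrightarrow> proj cs (f (j, p)) = map Inl w"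
  shows "proj cs (vsub f U) = vsub g (proj cs' U)"
  using assms
proof (induction U)
  case (Cons x U)
  then have IH: "proj cs (vsub f U) = vsub g (proj cs' U)" by auto
  show ?case
  proof (cases x)
    case (Inr v)
    obtain j p where v: "v = (j, p)" by force
    then show ?thesis using IH Inr Cons.prems[of j p] by (auto split: option.splits)
  qed (use IH in auto)
qed simp

text \<open>Types are correct unconditionally, words only up to repetitions. A repetition in a part
  of the output is one in the whole, so the escape clause of \<open>correct\<close> passes through
  concatenation and calls.\<close>

lemma ev_correct:
  fixes ts es :: "nat tr list"
  defines "ch \<equiv> restr (length ts) (\<lambda>i. map lin ts ! i)" and "fs \<equiv> map (mtt_val (mrules M)) ts"
  assumes IH: "\<And>t q es'. t \<in> set ts \<Longrightarrow> q \<in> mQ M \<Longrightarrow> length es' = rank q \<Longrightarrow>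
      ty (mtt_val (mrules M) t q es') = fst (lin t q (map ty es')) \<and>
      (\<forall>p\<in>P. correct es' (W p (mtt_val (mrules M) t q es')) (snd (lin t q (map ty es')) p))"
  shows "wf_rhs G (mQ M) (length ts) (length es) e \<Longrightarrow>
    ty (rhs_val fs es e) = fst (ev id ch (map ty es) e) \<and>
    (\<forall>p\<in>P. correct es (W p (rhs_val fs es e)) (snd (ev id ch (map ty es) e) p))"
proof (induction e)
  case (RO g as)
  let ?vs = "map (ev id ch (map ty es)) as" and ?xs = "map (rhs_val fs es) as"
  have arg: "ty (?xs ! i) = fst (?vs ! i) \<and> (\<forall>p\<in>P. correct es (W p (?xs ! i)) (snd (?vs ! i) p))"
    if "i < length as" for i
  proof -
    have "wf_rhs G (mQ M) (length ts) (length es) (as ! i)" using RO.prems that by (simp add: list_all_iff)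
    from RO.IH[OF nth_mem[OF that] this] show ?thesis unfolding nth_map[OF that] by blast
  qed
  have tys: "map fst ?vs = map ty ?xs"
    by (rule nth_equalityI) (use arg in auto)
  have main: "correct es (fill (\<lambda>i p'. W p' (?xs ! i)) tm) (concat (map (case_sum (\<lambda>a. if a \<in> A then [Inl (id a)] else [])
         (\<lambda>(i, p'). look ?vs i p')) tm))"
    if "\<forall>i p'. Inr (i, p') \<in> set tm \<longrightarrow> i < length as \<and> p' \<in> P" for tm :: "'p tmpl"
    using that
  proof (induction tm)
    case Nil
    show ?case unfolding correct_def by (intro disjI2 exI[of _ "[]"]) simp
  next
    case (Cons x tm)
    then have IH': "correct es (fill (\<lambda>i p'. W p' (?xs ! i)) tm) (concat (map (case_sum (\<lambda>a. if a \<in> A then [Inl (id a)] else [])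
         (\<lambda>(i, p'). look ?vs i p')) tm))" (is "correct es ?z ?w") by simp
    have x: "correct es (fill (\<lambda>i p'. W p' (?xs ! i)) [x])
        (case_sum (\<lambda>a. if a \<in> A then [Inl (id a)] else []) (\<lambda>(i, p'). look ?vs i p') x)"
      (is "correct es ?z' ?w'")
    proof (cases x)
      case (Inl a)
      then show ?thesis unfolding correct_def by (intro disjI2 exI[of _ "[Inl a]"]) auto
    next
      case (Inr ip)
      obtain i p where "ip = (i, p)" by force
      then show ?thesis using Cons.prems Inr arg[of i] by (auto simp: look_def)
    qed
    have z: "fill (\<lambda>i p'. W p' (?xs ! i)) (x # tm) = ?z' @ ?z"
      using fill_simps(4)[of _ "[x]" tm] by simp
    show ?case
    proof (cases "dup A ?z' \<or> dup A ?z")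
      case True
      then have "dup A (?z' @ ?z)" by (auto elim!: dup_sublist)
      then show ?thesis unfolding correct_def z by blast
    next
      case False
      with x IH' obtain U U' where "valid (length es) U'" "?z' = inst_vars es U'" "proj (map ty es) U' = ?w'"
        "valid (length es) U" "?z = inst_vars es U" "proj (map ty es) U = ?w"
        unfolding correct_def by blast
      then show ?thesis unfolding correct_def z by (intro disjI2 exI[of _ "U' @ U"]) simp
    qed
  qed
  have val: "\<forall>i p'. Inr (i, p') \<in> set (tmpl g (map ty ?xs) p) \<longrightarrow> i < length as \<and> p' \<in> P" if "p \<in> P" for p
    using tmpl_valid[OF that, of _ _ g ?xs] by simp
  show ?case
  proof (intro conjI ballI)
    show "ty (rhs_val fs es (RO g as)) = fst (ev id ch (map ty es) (RO g as))"
      by (simp only: rhs_val.simps ev.simps tys ty_Nd fst_conv)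
    show "correct es (W p (rhs_val fs es (RO g as))) (snd (ev id ch (map ty es) (RO g as)) p)" if "p \<in> P" for p
      using main[OF val[OF that]] by (simp only: rhs_val.simps ev.simps tys W_Nd[OF that] snd_conv)
  qed
next
  case (RC q i as)
  let ?vs = "map (ev id ch (map ty es)) as" and ?xs = "map (rhs_val fs es) as"
  from RC.prems have q: "q \<in> mQ M" "length as = rank q" and i: "i - 1 < length ts" by auto
  have arg: "ty (?xs ! i) = fst (?vs ! i) \<and> (\<forall>p\<in>P. correct es (W p (?xs ! i)) (snd (?vs ! i) p))"
    if "i < length as" for i
  proof -
    have "wf_rhs G (mQ M) (length ts) (length es) (as ! i)" using RC.prems that by (simp add: list_all_iff)
    from RC.IH[OF nth_mem[OF that] this] show ?thesis unfolding nth_map[OF that] by blast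
  qed
  have tys: "map fst ?vs = map ty ?xs"
    by (rule nth_equalityI) (use arg in auto)
  have c: "(q, map ty ?xs) \<in> calls" using q by (auto simp: calls_def)
  let ?t = "ts ! (i - 1)"
  have val: "rhs_val fs es (RC q i as) = mtt_val (mrules M) ?t q ?xs" using i by (simp add: fs_def)
  have ch: "fst (ch (i - 1) q (map ty ?xs)) = fst (lin ?t q (map ty ?xs))"
    "p \<in> P \<Longrightarrow> snd (ch (i - 1) q (map ty ?xs)) p = snd (lin ?t q (map ty ?xs)) p" for p
    using i c by (auto simp: ch_def restr_def)
  have sub: "ty (mtt_val (mrules M) ?t q ?xs) = fst (lin ?t q (map ty ?xs)) \<and>
      (\<forall>p\<in>P. correct ?xs (W p (mtt_val (mrules M) ?t q ?xs)) (snd (lin ?t q (map ty ?xs)) p))"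
    by (rule IH) (use i q in auto)
  have main: "correct es (W p (mtt_val (mrules M) ?t q ?xs))
      (vsub (\<lambda>(j, p'). look ?vs (j - 1) p') (snd (lin ?t q (map ty ?xs)) p))" if p: "p \<in> P" for p
  proof (cases "dup A (W p (mtt_val (mrules M) ?t q ?xs))")
    case True
    then show ?thesis by (simp add: correct_def)
  next
    case False
    with sub p obtain U where U: "valid (length ?xs) U" "W p (mtt_val (mrules M) ?t q ?xs) = inst_vars ?xs U"
      "proj (map ty ?xs) U = snd (lin ?t q (map ty ?xs)) p"
      unfolding correct_def by blast
    \<comment> \<open>Only arguments that occur in \<open>U\<close> inherit the absence of
      repetitions from the output. A deleted argument may contain repetitions, so a factorisation is
      chosen just for the occurring variables.\<close>
    have ex: "\<exists>U'. valid (length es) U' \<and> W p' (?xs ! (j - 1)) = inst_vars es U' \<and>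
        proj (map ty es) U' = look ?vs (j - 1) p'" if "Inr (j, p') \<in> set U" for j p'
    proof -
      have "1 \<le> j" "j \<le> length as" and p': "p' \<in> P" using U(1) that by (auto simp: valid_def)
      then have j: "j - 1 < length as" by simp
      have "\<not> dup A (W p' (?xs ! (j - 1)))"
        using False dup_sublist[OF _ sublist_inst_vars[OF that]] U(2) by metis
      then show ?thesis using arg[OF j] j p' unfolding correct_def by (auto simp: look_def)
    qed
    have "\<forall>v. \<exists>U'. Inr v \<in> set U \<longrightarrow> valid (length es) U' \<and>
        W (snd v) (?xs ! (fst v - 1)) = inst_vars es U' \<and> proj (map ty es) U' = look ?vs (fst v - 1) (snd v)"
      using ex by (metis prod.collapse)
    from choice[OF this] obtain f where f: "\<And>j p'. Inr (j, p') \<in> set U \<Longrightarrow> valid (length es) (f (j, p')) \<and>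
        W p' (?xs ! (j - 1)) = inst_vars es (f (j, p')) \<and> proj (map ty es) (f (j, p')) = look ?vs (j - 1) p'"
      by (metis (no_types, lifting) fst_conv snd_conv)
    have "proj (map ty es) (vsub f U) = vsub (\<lambda>(j, p'). look ?vs (j - 1) p') (proj (map ty ?xs) U)"
    proof (rule proj_vsub)
      fix j p' w
      assume a: "Inr (j, p') \<in> set U" "sh (map ty ?xs ! (j - 1)) p' = Some w"
      then have "1 \<le> j" "j \<le> length ?xs" "p' \<in> P" using U(1) by (auto simp: valid_def)
      with a(2) have "short A (W p' (?xs ! (j - 1))) = Some w" using sh_nth by metis
      with f[OF a(1)] have "short A (inst_vars es (f (j, p'))) = Some w" by simp
      from short_SomeD[OF this] proj_short[of es "f (j, p')"] f[OF a(1)]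
      show "proj (map ty es) (f (j, p')) = map Inl w" by simp
    qed (use f in auto)
    moreover have "inst_vars es (vsub f U) = inst_vars ?xs U" by (rule inst_vars_vsub) (use f in auto)
    moreover have "valid (length es) (vsub f U)" by (rule valid_vsub) (use f in auto)
    ultimately show ?thesis unfolding correct_def U(2) U(3)[symmetric] by metis
  qed
  show ?case
  proof (intro conjI ballI)
    show "ty (rhs_val fs es (RC q i as)) = fst (ev id ch (map ty es) (RC q i as))"
      using sub by (simp only: val ev.simps tys fst_conv ch)
    show "correct es (W p (rhs_val fs es (RC q i as))) (snd (ev id ch (map ty es) (RC q i as)) p)" if "p \<in> P" for p
      using main[OF that] by (simp only: val ev.simps tys snd_conv ch(2)[OF that])
  qed
next
  case (RY j)
  then have j: "1 \<le> j" "j \<le> length es" "j - 1 < length es" by auto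
  have "correct es (W p (es ! (j - 1)))
      (case sh (map ty es ! (j - 1)) p of None \<Rightarrow> [Inr (j, p)] | Some w \<Rightarrow> map (Inl \<circ> id) w)" if "p \<in> P" for p
    unfolding correct_def using j that by (intro disjI2 exI[of _ "[Inr (j, p)]"]) (auto split: option.split)
  moreover have "map ty es ! (j - 1) = ty (es ! (j - 1))" using j by simp
  ultimately show ?case unfolding rhs_val.simps ev.simps fst_conv snd_conv by simp
qed

text \<open>\<open>clamp\<close> and \<open>keep_first\<close> act as identities here: the type
  belongs to an actual tree, and without repetitions the surviving variables are distinct.\<close>

lemma lin_correct:
  assumes "t \<in> T (mSig M)" "q \<in> mQ M" "length es = rank q"
  shows "ty (mtt_val (mrules M) t q es) = fst (lin t q (map ty es)) \<and>
      (\<forall>p\<in>P. correct es (W p (mtt_val (mrules M) t q es)) (snd (lin t q (map ty es)) p))"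
  using assms
proof (induction t arbitrary: q es)
  case (Nd s ts)
  let ?v = "ev id (restr (length ts) (\<lambda>i. map lin ts ! i)) (map ty es) (mrules M q s)"
  let ?x = "rhs_val (map (mtt_val (mrules M)) ts) es (mrules M q s)"
  have wf: "wf_rhs (mGam M) (mQ M) (length ts) (length es) (mrules M q s)"
    using Nd.prems wf_M by (auto simp: wf_mtt_def Nd_in_T_iff)
  have ev: "ty ?x = fst ?v \<and> (\<forall>p\<in>P. correct es (W p ?x) (snd ?v p))"
    by (rule ev_correct[OF Nd.IH wf]) (use Nd.prems in \<open>auto simp: Nd_in_T_iff\<close>)
  have "correct es (W p ?x) (keep_first params (snd ?v p))" if "p \<in> P" for p
  proof (cases "dup A (W p ?x)")
    case False
    with ev that obtain U where U: "valid (length es) U" "W p ?x = inst_vars es U" "proj (map ty es) U = snd ?v p"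
      unfolding correct_def by blast
    have "distinct (vars (proj (map ty es) U))" using False U not_distinct_dup by metis
    moreover have "rank q \<le> maxrank (mQ M)" using Nd.prems wf_M by (auto simp: maxrank_def wf_mtt_def)
    then have "(j, p') \<in> params" if "Inr (j, p') \<in> set U" for j p'
      using U(1) Nd.prems(3) that unfolding valid_def params_def by fastforce
    then have "set (vars (proj (map ty es) U)) \<subseteq> params"
      by (auto simp: vars_proj set_vars)
    ultimately have "keep_first params (snd ?v p) = snd ?v p" unfolding U(3) by (rule keep_first_id)
    with ev that show ?thesis by simp
  qed (simp add: correct_def)
  moreover have "clamp (fst ?v) = fst ?v"
    using ev by (auto simp: clamp_def) (metis rangeI)
  ultimately show ?case using ev by (simp add: Let_def)
qed (simp add: T_def)

text \<open>The initial state has no parameters, hence its word has no variables and piece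
  \<open>0\<close> is all of it.\<close>

lemma erased_correct:
  assumes "t \<in> T (mSig M)" "p \<in> P" "\<not> dup A (W p (mtt_val (mrules M) t (mq0 M) []))"
  shows "(mq0 M, [], p, 0) \<in> pieces"
    and "lW (mq0 M, [], p, 0) t = filter (\<lambda>x. x \<in> A) (W p (mtt_val (mrules M) t (mq0 M) []))"
proof -
  let ?z = "W p (mtt_val (mrules M) t (mq0 M) [])"
  have q: "mq0 M \<in> mQ M" "rank (mq0 M) = 0" using wf_M by (auto simp: wf_mtt_def)
  then show "(mq0 M, [], p, 0) \<in> pieces" using assms by (auto simp: pieces_def calls_def)
  from lin_correct[OF assms(1) q(1), of "[]"] q assms(2,3) obtain U
    where U: "valid 0 U" "?z = inst_vars [] U" "proj [] U = snd (lin t (mq0 M) []) p"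
    unfolding correct_def by auto
  have "piece 0 (proj [] U) = filter (\<lambda>x. x \<in> A) (inst_vars [] U)" if "valid 0 U" for U
    using that
  proof (induction U)
    case (Cons x U)
    then show ?case by (cases x) (auto simp: valid_def)
  qed simp
  from this[OF U(1)] show "lW (mq0 M, [], p, 0) t = filter (\<lambda>x. x \<in> A) ?z"
    unfolding lW_def prod.case U(2) U(3)[symmetric] .
qed

end

lemma streaming_erase:
  assumes "streaming h" "MTT_fun f" "finite A"
  shows "\<exists>h'. streaming h' \<and> (\<forall>t s. f t = Some s \<longrightarrow> \<not> dup A (h s) \<longrightarrow> h' t = filter (\<lambda>x. x \<in> A) (h s))"
proof -
  obtain P :: "nat set" and ty :: "nat tr \<Rightarrow> nat" and W ty_step tmpl p where
    sys: "string_system P ty W ty_step tmpl" and p: "p \<in> P" "h = W p"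
    using assms(1) unfolding streaming_def by blast
  obtain M where M: "wf_mtt M" "f = mtt_fun M" using assms(2) unfolding MTT_fun_def by blast
  obtain ty' st' tm' where sys': "string_system P (\<lambda>t. (ty t, ty' t)) W st' tm'"
    and sh: "\<forall>p\<in>P. \<forall>t. ty' t p = short A (W p t)"
    using string_system.refine_types[OF sys assms(3)] by blast
  interpret erasing P "\<lambda>t. (ty t, ty' t)" W st' tm' A snd M
    using sys' sh M(1) by (simp add: erasing_def erasing_axioms_def)
  have x: "(mq0 M, [], p, 0) \<in> pieces"
    using M(1) p(1) by (auto simp: pieces_def calls_def wf_mtt_def)
  have "lW (mq0 M, [], p, 0) t = filter (\<lambda>x. x \<in> A) (h s)" if "f t = Some s" "\<not> dup A (h s)" for t s
    using mtt_fun_val[OF M(1), of t s] erased_correct(2)[of t p] that M(2) p by simp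
  with erased.streaming_W[OF x] show ?thesis by blast
qed

section \<open>The lower bound\<close>

lemma comp_chain_append: "comp_chain (fs @ [f]) t = Option.bind (comp_chain fs t) f"
  by (induction fs arbitrary: t) (auto simp: bind_assoc split: bind_splits)

text \<open>\<open>z l i m\<close> is the string after \<open>l\<close> stages on the input with
  \<open>i\<close> context copies around \<open>S m\<close>, and \<open>A l\<close> collects the
  letters available before stage \<open>l + 1\<close>. Erasure stops at \<open>z 1\<close>, whose
  decorations expose \<open>i\<close>.\<close>

locale hard_family =
  fixes C :: "nat tr \<Rightarrow> nat tr" and g pre post and S :: "nat \<Rightarrow> nat tr"
    and A :: "nat \<Rightarrow> nat set" and z :: "nat \<Rightarrow> nat \<Rightarrow> nat \<Rightarrow> nat list"
  assumes C: "C s = Nd g (pre @ s # post)"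
    and finite_A: "finite (A j)"
    and erase: "filter (\<lambda>x. x \<in> A (Suc j)) (z (Suc (Suc j)) i m) = z (Suc j) i m"
    and no_dup: "\<not> dup (A (Suc j)) (z (Suc (Suc j)) i m)"
    and many: "m \<le> cnt (A 0) (z (Suc 0) i m)"
    and visible: "\<exists>N. \<forall>i\<le>I. \<forall>i'\<le>I. \<forall>m u. sublist u (z (Suc 0) i m) \<longrightarrow>
       sublist u (z (Suc 0) i' m) \<longrightarrow> cnt (A 0) u > N \<longrightarrow> i = i'"
begin

text \<open>Transducers are removed from the end of the chain, where the streaming map reads; each
  removal lowers the stage of \<open>z\<close> by one.\<close>

lemma not_streaming:
  assumes "streaming h" "set fs \<subseteq> {f. MTT_fun f}"
    "\<And>i m. \<exists>s. comp_chain fs ((C ^^ i) (S m)) = Some s \<and> h s = z (Suc (length fs)) i m"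
  shows False
  using assms
proof (induction fs arbitrary: h rule: rev_induct)
  case Nil
  then have "h ((C ^^ i) (S m)) = z (Suc 0) i m" for i m by simp
  with not_streaming_if_context_visible[OF Nil(1) C, where S = S and A = "A 0"] many visible show ?case by simp
next
  case (snoc f fs)
  let ?t = "\<lambda>i m. (C ^^ i) (S m)"
  obtain h' where h': "streaming h'" and
    e: "\<And>t s. f t = Some s \<Longrightarrow> \<not> dup (A (Suc (length fs))) (h s) \<Longrightarrow>
      h' t = filter (\<lambda>x. x \<in> A (Suc (length fs))) (h s)"
    using streaming_erase[OF snoc.prems(1), of f "A (Suc (length fs))"] snoc.prems(2) finite_A by auto
  have "\<exists>s. comp_chain fs (?t i m) = Some s \<and> h' s = z (Suc (length fs)) i m" for i m
  proof -
    obtain s where s: "comp_chain (fs @ [f]) (?t i m) = Some s" "h s = z (Suc (Suc (length fs))) i m"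
      using snoc.prems(3)[of i m] by auto
    from s(1) obtain s' where s': "comp_chain fs (?t i m) = Some s'" "f s' = Some s"
      unfolding comp_chain_append by (auto simp: bind_eq_Some_conv)
    have "\<not> dup (A (Suc (length fs))) (h s)" unfolding s(2) by (rule no_dup)
    with e[OF s'(2)] s' show ?thesis by (simp add: s(2) erase)
  qed
  with snoc.IH[OF h'] snoc.prems(2) show ?case by auto
qed

lemma not_in_cpow_MTT:
  assumes "\<And>i m. \<exists>s. f ((C ^^ i) (S m)) = Some s \<and> yield s = z (Suc j) i m"
  shows "f \<notin> cpow {g. MTT_fun g} j"
proof
  assume f: "f \<in> cpow {g. MTT_fun g} j"
  show False
  proof (cases "j = 0")
    case True
    with f obtain S' where S': "f = (\<lambda>t. if t \<in> T S' then Some t else None)" by (auto simp: cpow_def)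
    have "\<exists>s. comp_chain [] ((C ^^ i) (S m)) = Some s \<and> yield s = z (Suc (length ([] :: tf list))) i m" for i m
      using assms[of i m] True by (auto simp: S' split: if_splits)
    from not_streaming[OF streaming_yield _ this] show False by simp
  next
    case False
    with f obtain fs where "f = comp_chain fs" "length fs = j" "set fs \<subseteq> {g. MTT_fun g}" by (auto simp: cpow_def)
    with not_streaming[OF streaming_yield, of fs] assms show False by auto
  qed
qed

end


section \<open>Big-step evaluation of configuration trees\<close>

inductive evals :: "('c \<Rightarrow> 'c tr option) \<Rightarrow> 'c tr \<Rightarrow> 'c tr \<Rightarrow> bool" for st where
  Lf: "st c = Some r \<Longrightarrow> evals st r s \<Longrightarrow> evals st (Lf c) s"
| Nd: "list_all2 (evals st) ts ss \<Longrightarrow> evals st (Nd g ts) (Nd g ss)"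

inductive_cases evals_LfE: "evals st (Lf c) s"
inductive_cases evals_NdE: "evals st (Nd g ts) s"

lemma ground_Nd: "ground (Nd g ts) \<longleftrightarrow> (\<forall>t\<in>set ts. ground t)"
  by (auto simp: ground_def)

lemma evals_ground: "evals st x s \<Longrightarrow> ground s"
proof (induction rule: evals.induct)
  case (Nd ts ss g)
  then have "list_all2 (\<lambda>_. ground) ts ss" by (rule list_all2_mono) simp
  then show ?case by (simp add: ground_Nd list_all2_conv_all_nth all_set_conv_all_nth)
qed

lemma evals_refl: "ground x \<Longrightarrow> evals st x x"
proof (induction x)
  case (Nd g ts)
  then have "evals st t t" if "t \<in> set ts" for t using that unfolding ground_Nd by blast
  then have "list_all2 (evals st) ts ts" by (rule list.rel_refl_strong)
  then show ?case by (rule evals.Nd)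
next
  case (Lf c)
  then show ?case by (simp add: ground_def)
qed

lemma evals_deterministic: "evals st x s \<Longrightarrow> evals st x s' \<Longrightarrow> s = s'"
proof (induction arbitrary: s' rule: evals.induct)
  case (Lf c r s)
  from Lf.prems obtain r' where "st c = Some r'" "evals st r' s'" by (rule evals_LfE)
  with Lf.hyps(1) Lf.IH show ?case by simp
next
  case (Nd ts ss g)
  from Nd.prems obtain ss' where s': "s' = Nd g ss'" "list_all2 (evals st) ts ss'" by (rule evals_NdE)
  have "ss = ss'"
    by (rule nth_equalityI) (use Nd.IH s'(2) in \<open>auto simp: list_all2_conv_all_nth\<close>)
  with s' show ?case by simp
qed

lemma rw_evals: "rw st x y \<Longrightarrow> evals st y s \<Longrightarrow> evals st x s"
proof (induction arbitrary: s rule: rw.induct)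
  case (leaf c r)
  then show ?case by (rule evals.Lf)
next
  case (inner i ts t' g)
  then obtain ss where "s = Nd g ss" "list_all2 (evals st) (ts[i := t']) ss" using evals_NdE by metis
  with inner show ?case
    by (auto intro!: evals.Nd simp: list_all2_conv_all_nth nth_list_update) metis
qed

lemma rw_rtranclp_evals: "(rw st)\<^sup>*\<^sup>* x y \<Longrightarrow> evals st y s \<Longrightarrow> evals st x s"
  by (induction rule: converse_rtranclp_induct) (auto intro: rw_evals)

lemma rw_rtranclp_inner:
  assumes "i < length ts" "(rw st)\<^sup>*\<^sup>* (ts ! i) t'"
  shows "(rw st)\<^sup>*\<^sup>* (Nd g ts) (Nd g (ts[i := t']))"
  using assms(2)
proof induction
  case (step y z)
  then have "rw st (Nd g (ts[i := y])) (Nd g ((ts[i := y])[i := z]))"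
    by (intro rw.inner) (use assms(1) in auto)
  with step show ?case by simp
qed simp

lemma evals_rw: "evals st x s \<Longrightarrow> (rw st)\<^sup>*\<^sup>* x s"
proof (induction rule: evals.induct)
  case (Lf c r s)
  then show ?case by (meson converse_rtranclp_into_rtranclp rw.leaf)
next
  case (Nd ts ss g)
  have len: "length ts = length ss" using Nd list_all2_lengthD by blast
  have "n \<le> length ts \<Longrightarrow> (rw st)\<^sup>*\<^sup>* (Nd g ts) (Nd g (take n ss @ drop n ts))" for n
  proof (induction n)
    case (Suc n)
    let ?l = "take n ss @ drop n ts"
    have n: "n < length ?l" "?l ! n = ts ! n" using Suc.prems len by (auto simp: nth_append)
    have "(rw st)\<^sup>*\<^sup>* (ts ! n) (ss ! n)" using Nd Suc.prems by (auto simp: list_all2_conv_all_nth)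
    with n have "(rw st)\<^sup>*\<^sup>* (Nd g ?l) (Nd g (?l[n := ss ! n]))" by (intro rw_rtranclp_inner) auto
    moreover have "?l[n := ss ! n] = take (Suc n) ss @ drop (Suc n) ts"
      using Suc.prems len
      by (auto simp: list_update_append take_Suc_conv_app_nth Cons_nth_drop_Suc[symmetric] min_def)
    ultimately show ?case using Suc by (auto intro: rtranclp_trans)
  qed simp
  from this[of "length ts"] len show ?case by simp
qed

text \<open>Every ground reduct is a big-step result and big-step evaluation is deterministic. This
  yields the uniqueness behind \<open>THE\<close> without proving confluence.\<close>

lemma rw_output_evals:
  assumes "evals st (Lf c) s"
  shows "rw_output st c = Some (map_tr (\<lambda>_. 0) s)"
proof -
  have "(rw st)\<^sup>*\<^sup>* (Lf c) s \<and> ground s" using assms evals_rw evals_ground by blast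
  moreover have "s' = s" if "(rw st)\<^sup>*\<^sup>* (Lf c) s' \<and> ground s'" for s'
    using that assms rw_rtranclp_evals evals_refl evals_deterministic by metis
  ultimately show ?thesis unfolding rw_output_def by (metis (mono_tags, lifting) the_equality)
qed

section \<open>Binary trees with labelled leaves\<close>

datatype bt = BL nat | BN bt bt

text \<open>The leaf type is left open so that the same tree can be an input, an output and a ground
  configuration tree.\<close>

primrec enc :: "bt \<Rightarrow> 'c tr" where
  "enc (BL x) = Nd (x, 0) []"
| "enc (BN l r) = Nd (0, 2) [enc l, enc r]"

primrec leaves :: "bt \<Rightarrow> nat set" where
  "leaves (BL x) = {x}"
| "leaves (BN l r) = leaves l \<union> leaves r"

definition binary :: "nat set \<Rightarrow> sym set" where
  "binary X = insert (0, 2) ((\<lambda>x. (x, 0)) ` X)"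

lemma map_tr_enc [simp]: "map_tr f (enc b) = enc b"
  by (induction b) auto

lemma enc_inject [simp]: "(enc b :: 'c tr) = enc b' \<longleftrightarrow> b = b'"
proof (induction b arbitrary: b')
  case (BL x)
  then show ?case by (cases b') auto
next
  case (BN l r)
  then show ?case by (cases b') auto
qed

lemma wf_enc: "wf (binary X) Y (enc b) \<longleftrightarrow> leaves b \<subseteq> X"
  by (induction b) (auto simp: binary_def rank_def)

lemma in_T_binary_iff: "t \<in> T (binary X) \<longleftrightarrow> (\<exists>b. t = enc b \<and> leaves b \<subseteq> X)"
proof
  assume "t \<in> T (binary X)"
  then show "\<exists>b. t = enc b \<and> leaves b \<subseteq> X"
  proof (induction t)
    case (Nd s ts)
    then have s: "s \<in> binary X" "length ts = rank s" "\<forall>t\<in>set ts. t \<in> T (binary X)"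
      by (auto simp: Nd_in_T_iff)
    show ?case
    proof (cases "s = (0, 2)")
      case True
      with s(2) obtain l r where "ts = [l, r]"
        by (auto simp: rank_def length_Suc_conv numeral_2_eq_2)
      with Nd.IH[of l] Nd.IH[of r] s(3) obtain bl br
        where "l = enc bl" "leaves bl \<subseteq> X" "r = enc br" "leaves br \<subseteq> X" by (metis list.set_intros)
      with True \<open>ts = [l, r]\<close> show ?thesis by (intro exI[of _ "BN bl br"]) auto
    next
      case False
      with s obtain x where "s = (x, 0)" "x \<in> X" "ts = []" by (auto simp: binary_def rank_def)
      then show ?thesis by (intro exI[of _ "BL x"]) auto
    qed
  qed (simp add: T_def)
next
  assume "\<exists>b. t = enc b \<and> leaves b \<subseteq> X"
  then show "t \<in> T (binary X)" by (auto simp: T_def wf_enc)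
qed

lemma maxrank_binary: "finite X \<Longrightarrow> maxrank (binary X) = 2"
  by (auto simp: maxrank_def binary_def rank_def image_image intro!: Max_eqI)

lemma subt_append: "subt t (u @ v) = Option.bind (subt t u) (\<lambda>s. subt s v)"
  by (induction t u rule: subt.induct) auto

abbreviation node :: "bt \<Rightarrow> nat list \<Rightarrow> bt \<Rightarrow> bool" where
  "node b u b' \<equiv> subt (enc b :: nat tr) u = Some (enc b')"

lemma subt_enc: "subt (enc b :: nat tr) u = Some s \<Longrightarrow> \<exists>b'. s = enc b'"
proof (induction u arbitrary: b)
  case (Cons i u)
  then show ?case by (cases b) (auto simp: nth_Cons split: if_splits nat.splits)
qed auto

lemma node_snoc:
  assumes "node b (u @ [i]) b'"
  obtains l r where "node b u (BN l r)" "i = 1 \<or> i = 2"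
proof -
  from assms obtain s :: "nat tr" where s: "subt (enc b) u = Some s" "subt s [i] = Some (enc b')"
    by (auto simp: subt_append bind_eq_Some_conv)
  from subt_enc[OF s(1)] obtain c where c: "s = enc c" by blast
  show thesis
  proof (cases c)
    case (BN l r)
    with c s(2) have "1 \<le> i" "i \<le> 2" by (auto split: if_splits)
    then have "i = 1 \<or> i = 2" by linarith
    with that s(1) c BN show thesis by simp
  qed (use c s(2) in \<open>auto split: if_splits\<close>)
qed

lemma node_children:
  assumes "node b u (BN l r)"
  shows "node b (u @ [1]) l" "node b (u @ [2]) r"
  using assms by (auto simp: subt_append)

lemma lab_enc:
  "node b u (BL x) \<Longrightarrow> lab (enc b :: nat tr) u = Some (x, 0)"
  "node b u (BN l r) \<Longrightarrow> lab (enc b :: nat tr) u = Some (0, 2)"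
  by (auto simp: lab_def)

lemma child_info_node: "node b u b' \<Longrightarrow> child_info u \<in> {None, Some 1, Some 2}"
  by (cases u rule: rev_cases) (auto simp: child_info_def elim: node_snoc)

definition letter :: "nat \<Rightarrow> nat \<Rightarrow> nat" where
  "letter j c = prod_encode (j, c)"

lemma letter_eq_iff [simp]: "letter j c = letter j' c' \<longleftrightarrow> j = j' \<and> c = c'"
  by (simp add: letter_def)

section \<open>Decorating leaves with their addresses\<close>

primrec spine :: "nat \<Rightarrow> nat list \<Rightarrow> bt" where
  "spine j [] = BL (letter j 0)"
| "spine j (c # u) = BN (BL (letter j c)) (spine j u)"

text \<open>\<open>u\<close> is the address read from the node up to the root, the order in which a
  climbing transducer prints it.\<close>

primrec dec :: "nat \<Rightarrow> nat list \<Rightarrow> bt \<Rightarrow> bt" where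
  "dec j u (BL x) = BN (BL x) (spine j u)"
| "dec j u (BN l r) = BN (dec j (1 # u) l) (dec j (2 # u) r)"

definition levels :: "nat \<Rightarrow> nat set" where
  "levels j = {letter l c | l c. l \<le> j \<and> c \<le> 2}"

lemma finite_levels: "finite (levels j)"
proof -
  have "levels j = (\<lambda>(l, c). letter l c) ` ({..j} \<times> {..2})" by (auto simp: levels_def)
  then show ?thesis by simp
qed

definition climb :: "nat \<Rightarrow> nat option \<Rightarrow> (nat \<times> dir) tr" where
  "climb j c = (case c of None \<Rightarrow> Nd (letter j 0, 0) []
     | Some i \<Rightarrow> Nd (0, 2) [Nd (letter j i, 0) [], Lf (1, Up)])"

definition dec_twt :: "nat \<Rightarrow> twt" where
  "dec_twt j = \<lparr>wQ = {0, 1}, wSig = binary (levels j), wGam = binary (levels (Suc j)), wq0 = 0,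
     wdelta = (\<lambda>q s c. if s \<in> binary (levels j) \<and> c \<in> {None, Some 1, Some 2} then
       (if q = 0 then Some (if s = (0, 2) then Nd s [Lf (0, Down 1), Lf (0, Down 2)]
                            else Nd (0, 2) [Nd s [], climb (Suc j) c])
        else if q = 1 \<and> s = (0, 2) then Some (climb (Suc j) c) else None) else None)\<rparr>"

lemma wf_dec_twt: "wf_twt (dec_twt j)"
proof -
  have climb: "wf (binary (levels (Suc j))) {(q', d). q' \<in> {0, 1} \<and> valid_dir s d} (climb (Suc j) c)"
    if "c \<in> {None, Some 1, Some 2}" for c s
    using that by (auto simp: climb_def binary_def rank_def levels_def valid_dir_def)
  have "levels j \<subseteq> levels (Suc j)" by (auto simp: levels_def)
  then show ?thesis
    using climb
    by (auto simp: wf_twt_def dec_twt_def ranked_alphabet_def finite_levels maxrank_binary rank_def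
        valid_dir_def split: if_splits) (auto simp: binary_def finite_levels rank_def)
qed

text \<open>Stated for the right-hand side \<open>climb\<close> rather than for a configuration
  because the climb begins inside the rule for a leaf, in state \<open>0\<close>, and continues in
  state \<open>1\<close>.\<close>

lemma climb_evals:
  fixes b :: bt and j :: nat
  defines "st \<equiv> twt_step (dec_twt j) (enc b)"
  assumes "leaves b \<subseteq> levels j" "node b u b'"
  shows "(\<forall>(q', d) \<in> set_tr (climb (Suc j) (child_info u)). move (enc b :: nat tr) u d \<noteq> None) \<and>
    evals st (map_tr (\<lambda>(q', d). (the (move (enc b :: nat tr) u d), q')) (climb (Suc j) (child_info u))) (enc (spine (Suc j) (rev u)))"
  using assms(3)
proof (induction u arbitrary: b' rule: rev_induct)
  case Nil
  show ?case by (auto simp: climb_def child_info_def intro!: evals.Nd)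
next
  case (snoc i u)
  from node_snoc[OF snoc.prems] obtain l r where u: "node b u (BN l r)" by metis
  from snoc.IH[OF u] have IH: "\<forall>(q', d) \<in> set_tr (climb (Suc j) (child_info u)). move (enc b :: nat tr) u d \<noteq> None"
    "evals st (map_tr (\<lambda>(q', d). (the (move (enc b :: nat tr) u d), q')) (climb (Suc j) (child_info u))) (enc (spine (Suc j) (rev u)))"
    by auto
  have "child_info u \<in> {None, Some 1, Some 2}" using u by (rule child_info_node)
  then have "st (u, 1) = Some (map_tr (\<lambda>(q', d). (the (move (enc b :: nat tr) u d), q')) (climb (Suc j) (child_info u)))"
    using IH(1) lab_enc(2)[OF u] by (auto simp: st_def twt_step_def dec_twt_def binary_def)
  then have "evals st (Lf (u, 1)) (enc (spine (Suc j) (rev u)))" using IH(2) by (rule evals.Lf)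
  then show ?case
    by (auto simp: climb_def child_info_def move_def intro!: evals.Nd)
qed

lemma dec_evals:
  fixes b :: bt and j :: nat
  defines "st \<equiv> twt_step (dec_twt j) (enc b)"
  assumes b: "leaves b \<subseteq> levels j"
  shows "node b u b' \<Longrightarrow> leaves b' \<subseteq> levels j \<Longrightarrow> evals st (Lf (u, 0)) (enc (dec (Suc j) (rev u) b'))"
proof (induction b' arbitrary: u)
  case (BL x)
  have ci: "child_info u \<in> {None, Some 1, Some 2}" using BL(1) by (rule child_info_node)
  from climb_evals[OF b BL(1)]
  have c: "\<forall>(q', d) \<in> set_tr (climb (Suc j) (child_info u)). move (enc b :: nat tr) u d \<noteq> None"
    "evals st (map_tr (\<lambda>(q', d). (the (move (enc b :: nat tr) u d), q')) (climb (Suc j) (child_info u))) (enc (spine (Suc j) (rev u)))"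
    by (auto simp: st_def)
  have "st (u, 0) = Some (map_tr (\<lambda>(q', d). (the (move (enc b :: nat tr) u d), q')) (Nd (0, 2) [Nd (x, 0) [], climb (Suc j) (child_info u)]))"
    using ci c(1) lab_enc(1)[OF BL(1)] BL(2) by (auto simp: st_def twt_step_def dec_twt_def binary_def)
  then show ?case
    by (rule evals.Lf) (use c(2) in \<open>auto intro!: evals.Nd\<close>)
next
  case (BN l r)
  have ci: "child_info u \<in> {None, Some 1, Some 2}" using BN.prems(1) by (rule child_info_node)
  note ch = node_children[OF BN.prems(1)]
  have "st (u, 0) = Some (Nd (0, 2) [Lf (u @ [1], 0), Lf (u @ [2], 0)])"
    using ci ch lab_enc(2)[OF BN.prems(1)] by (auto simp: st_def twt_step_def dec_twt_def binary_def move_def)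
  then show ?case
    by (rule evals.Lf) (use BN.IH(1)[OF ch(1)] BN.IH(2)[OF ch(2)] BN.prems(2) in \<open>auto intro!: evals.Nd\<close>)
qed

lemma twt_fun_dec: "leaves b \<subseteq> levels j \<Longrightarrow> twt_fun (dec_twt j) (enc b) = Some (enc (dec (Suc j) [] b))"
  using rw_output_evals[OF dec_evals[of b j "[]" b]]
  by (auto simp: twt_fun_def in_T_binary_iff dec_twt_def)

lemma twt_fun_decD: "twt_fun (dec_twt j) t = Some s \<Longrightarrow> \<exists>b. t = enc b \<and> s = enc (dec (Suc j) [] b)"
  using twt_fun_dec
  by (auto simp: twt_fun_def in_T_binary_iff dec_twt_def split: if_splits)

lemma height_enc_BN [simp]:
  "height (enc (BN l r) :: 'c tr) = Suc (max (height (enc l :: 'c tr)) (height (enc r :: 'c tr)))"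
  by simp

lemma height_spine: "height (enc (spine j u) :: 'c tr) = length u"
  by (induction u) auto

text \<open>The factor 2 arises because a leaf at depth \<open>d\<close> receives a spine of length
  \<open>d\<close> plus the length of \<open>u\<close>.\<close>

lemma height_dec: "height (enc (dec j u b) :: 'c tr) \<le> 2 * height (enc b :: 'c tr) + length u + 1"
proof (induction b arbitrary: u)
  case (BN l r)
  from BN.IH(1)[of "1 # u"] BN.IH(2)[of "2 # u"] show ?case
    by (simp only: dec.simps height_enc_BN length_Cons) (auto simp: max_def)
qed (simp add: height_spine)

lemma LHI_dec: "LHI (twt_fun (dec_twt j))"
  unfolding LHI_def
proof (intro exI allI impI)
  fix t s
  assume "twt_fun (dec_twt j) t = Some s"
  then obtain b where "t = enc b" "s = enc (dec (Suc j) [] b)" by (blast dest: twt_fun_decD)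
  with height_dec[of "Suc j" "[]" b] show "height s \<le> 2 * height t + 1" by simp
qed


section \<open>Iterated address decoration as a hard family\<close>

primrec addrs :: "nat list \<Rightarrow> bt \<Rightarrow> (nat \<times> nat list) list" where
  "addrs u (BL x) = [(x, u)]"
| "addrs u (BN l r) = addrs (1 # u) l @ addrs (2 # u) r"

definition dec_items :: "nat \<Rightarrow> bt \<Rightarrow> (nat \<times> nat list) list" where
  "dec_items j b = map (\<lambda>(x, u). (x, map (letter j) (u @ [0]))) (addrs [] b)"

lemma yield_spine: "yield (enc (spine j u)) = map (letter j) (u @ [0])"
  by (induction u) auto

lemma yield_dec: "yield (enc (dec j [] b)) = decorate (dec_items j b)"
proof -
  have "yield (enc (dec j u b)) = decorate (map (\<lambda>(x, u). (x, map (letter j) (u @ [0]))) (addrs u b))" for u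
    by (induction b arbitrary: u) (auto simp: yield_spine decorate_def)
  then show ?thesis by (simp add: dec_items_def)
qed

lemma yield_addrs: "map fst (addrs u b) = yield (enc b)"
  by (induction b arbitrary: u) auto

lemma fst_addrs: "(x, w) \<in> set (addrs u b) \<Longrightarrow> x \<in> leaves b"
  by (induction b arbitrary: u) auto

lemma snd_addrs: "(x, w) \<in> set (addrs u b) \<Longrightarrow> \<exists>v. w = v @ u"
proof (induction b arbitrary: u)
  case (BN l r)
  then show ?case by auto (metis append.assoc append_Cons append_Nil)+
qed auto

lemma distinct_addrs: "distinct (map snd (addrs u b))"
proof (induction b arbitrary: u)
  case (BN l r)
  have False if "(x, w) \<in> set (addrs (1 # u) l)" "(y, w) \<in> set (addrs (2 # u) r)" for x y w
  proof -
    from snd_addrs[OF that(1)] snd_addrs[OF that(2)] obtain v v' where "v @ 1 # u = v' @ 2 # u" by auto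
    then have "(v @ [1]) @ u = (v' @ [2]) @ u" by simp
    then show False by (simp only: append_same_eq append1_eq_conv) simp
  qed
  with BN show ?case by (auto simp: image_def) blast+
qed simp

primrec dec_iter :: "nat \<Rightarrow> bt \<Rightarrow> bt" where
  "dec_iter 0 b = b"
| "dec_iter (Suc j) b = dec (Suc j) [] (dec_iter j b)"

lemma leaves_spine: "set u \<subseteq> {1, 2} \<Longrightarrow> leaves (spine j u) \<subseteq> levels j"
  by (induction u) (auto simp: levels_def)

lemma leaves_dec: "set u \<subseteq> {1, 2} \<Longrightarrow> leaves b \<subseteq> levels j \<Longrightarrow> leaves (dec (Suc j) u b) \<subseteq> levels (Suc j)"
proof (induction b arbitrary: u)
  case (BL x)
  moreover have "levels j \<subseteq> levels (Suc j)" by (auto simp: levels_def)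
  ultimately show ?case using leaves_spine[of u "Suc j"] by auto
qed auto

lemma leaves_dec_iter: "leaves b \<subseteq> levels 0 \<Longrightarrow> leaves (dec_iter j b) \<subseteq> levels j"
  by (induction j) (auto intro!: leaves_dec[THEN subsetD])

lemma comp_chain_dec:
  "leaves b \<subseteq> levels 0 \<Longrightarrow> comp_chain (map (\<lambda>j. twt_fun (dec_twt j)) [0..<k]) (enc b) = Some (enc (dec_iter k b))"
  by (induction k) (simp_all add: comp_chain_append twt_fun_dec leaves_dec_iter)

lemma decorated_dec_items:
  assumes "leaves b \<subseteq> levels j"
  shows "decorated (levels j) (dec_items (Suc j) b)"
  using assms fst_addrs
  by unfold_locales (fastforce simp: dec_items_def levels_def)+

lemma distinct_dec_items: "distinct (map snd (dec_items j b))"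
proof -
  have "map snd (dec_items j b) = map (\<lambda>u. map (letter j) (u @ [0])) (map snd (addrs [] b))"
    by (auto simp: dec_items_def)
  moreover have "inj (\<lambda>u. map (letter j) (u @ [0]))" by (auto simp: inj_on_def dest!: map_injective[rotated])
  ultimately show ?thesis
    using distinct_addrs[of "[]" b] by (simp only: distinct_map[of _ "map snd (addrs [] b)"] inj_on_subset[OF _ subset_UNIV])
qed

primrec right_comb :: "nat \<Rightarrow> bt" where
  "right_comb 0 = BL (letter 0 0)"
| "right_comb (Suc m) = BN (BL (letter 0 0)) (right_comb m)"

text \<open>Each context copy adds a left edge above the comb, whose own edges lead right. Up to the
  last step to the leaf, the \<open>1\<close>s in the address of a comb leaf thus count the context
  copies.\<close>

primrec zigzag :: "nat \<Rightarrow> nat \<Rightarrow> bt" where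
  "zigzag 0 m = right_comb m"
| "zigzag (Suc i) m = BN (zigzag i m) (BL (letter 0 0))"

lemma leaves_zigzag: "leaves (zigzag i m) \<subseteq> levels 0"
proof -
  have "leaves (right_comb m) \<subseteq> levels 0" by (induction m) (auto simp: levels_def)
  then show ?thesis by (induction i) (auto simp: levels_def)
qed

lemma addrs_right_comb: "length (addrs u (right_comb m)) = Suc m \<and>
    (\<forall>r<m. addrs u (right_comb m) ! r = (letter 0 0, 1 # replicate r 2 @ u))"
proof (induction m arbitrary: u)
  case (Suc m)
  then show ?case by (auto simp: nth_Cons replicate_app_Cons_same split: nat.split)
qed simp

lemma addrs_zigzag: "\<exists>w. addrs u (zigzag i m) = addrs (replicate i 1 @ u) (right_comb m) @ w \<and> length w = i"
proof (induction i arbitrary: u)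
  case (Suc i)
  from Suc[of "1 # u"] show ?case by (auto simp: replicate_app_Cons_same)
qed simp

interpretation dec: hard_family "\<lambda>s. Nd (0, 2) [s, enc (BL (letter 0 0))]" "(0, 2)" "[]" "[enc (BL (letter 0 0))]"
  "\<lambda>m. enc (right_comb m)" levels "\<lambda>j i m. yield (enc (dec_iter j (zigzag i m)))"
proof
  fix j i m I
  have lv: "leaves (dec_iter j (zigzag i m)) \<subseteq> levels j" for j i m
    using leaves_dec_iter leaves_zigzag by blast
  have dec: "decorated (levels j) (dec_items (Suc j) (dec_iter j (zigzag i m)))" for j i m
    by (rule decorated_dec_items) (rule lv)
  show "finite (levels j)" by (rule finite_levels)
  show "filter (\<lambda>x. x \<in> levels (Suc j)) (yield (enc (dec_iter (Suc (Suc j)) (zigzag i m)))) =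
     yield (enc (dec_iter (Suc j) (zigzag i m)))"
    unfolding dec_iter.simps(2)[of "Suc j"] yield_dec filter_decorate[OF dec]
    by (simp add: dec_items_def yield_addrs[symmetric, of _ "[]"] case_prod_unfold o_def)
  show "\<not> dup (levels (Suc j)) (yield (enc (dec_iter (Suc (Suc j)) (zigzag i m))))"
    unfolding dec_iter.simps(2)[of "Suc j"] yield_dec
    by (rule decorate_not_dup) (rule dec, rule distinct_dec_items)
  have len: "length (dec_items 1 (zigzag i m)) = Suc (i + m)" for i m
    using addrs_zigzag[of "[]" i m] addrs_right_comb[of "replicate i 1" m] by (auto simp: dec_items_def)
  have z: "yield (enc (dec_iter (Suc 0) (zigzag i m))) = decorate (dec_items 1 (zigzag i m))" for i m
    by (simp add: yield_dec)
  have dec1: "decorated (levels 0) (dec_items 1 (zigzag i m))" for i m using dec[of 0] by simp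
  show "m \<le> cnt (levels 0) (yield (enc (dec_iter (Suc 0) (zigzag i m))))"
    unfolding z using cnt_decorate[OF dec1[of i m]] len[of i m] by simp
  have item: "dec_items 1 (zigzag i m) ! r = (letter 0 0, map (letter 1) (1 # replicate r 2 @ replicate i 1 @ [0]))"
    if "r < m" for r i m
    using that addrs_zigzag[of "[]" i m] addrs_right_comb[of "replicate i 1" m]
    by (auto simp: dec_items_def nth_append)
  show "\<exists>N. \<forall>i\<le>I. \<forall>i'\<le>I. \<forall>m u. sublist u (yield (enc (dec_iter (Suc 0) (zigzag i m)))) \<longrightarrow>
      sublist u (yield (enc (dec_iter (Suc 0) (zigzag i' m)))) \<longrightarrow> cnt (levels 0) u > N \<longrightarrow> i = i'"
    unfolding z
  \<comment> \<open>The last comb leaf and the at most \<open>I\<close> context leaves have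
    irregular addresses. More than \<open>I + 2\<close> letters force the item that is read to start
    at an index below \<open>m\<close>.\<close>
  proof (intro exI[of _ "I + 2"] allI impI)
    fix i i' m u
    assume i: "i \<le> I" "i' \<le> I" and u: "sublist u (decorate (dec_items 1 (zigzag i m)))"
      "sublist u (decorate (dec_items 1 (zigzag i' m)))" "cnt (levels 0) u > I + 2"
    obtain u1 a d a' u2 where ud: "u = u1 @ a # d @ a' # u2" "cnt (levels 0) u1 = 0" "cnt (levels 0) d = 0"
      "a \<in> levels 0" "a' \<in> levels 0"
      by (rule first_two_letters[of "levels 0" u]) (use u(3) in auto)
    obtain r where r: "r + cnt (levels 0) u \<le> Suc (i + m)" "dec_items 1 (zigzag i m) ! r = (a, d)"
      using decorate_sublist_item[OF dec1 u(1) ud] unfolding len by blast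
    obtain r' where r': "r' + cnt (levels 0) u \<le> Suc (i' + m)" "dec_items 1 (zigzag i' m) ! r' = (a, d)"
      using decorate_sublist_item[OF dec1 u(2) ud] unfolding len by blast
    have "r < m" "r' < m" using r(1) r'(1) u(3) i by linarith+
    then have "map (letter 1) (1 # replicate r 2 @ replicate i 1 @ [0]) = map (letter 1) (1 # replicate r' 2 @ replicate i' 1 @ [0])"
      using item r(2) r'(2) by simp
    then have "1 # replicate r 2 @ replicate i 1 @ [0] = 1 # replicate r' 2 @ replicate i' 1 @ [0::nat]"
      by (rule map_injective) (simp add: inj_on_def)
    \<comment> \<open>Counting the \<open>1\<close>s gives \<open>i + 1\<close> on one side and
      \<open>i' + 1\<close> on the other.\<close>
    then have "filter (\<lambda>x. x = 1) (1 # replicate r 2 @ replicate i 1 @ [0]) = filter (\<lambda>x. x = 1) (1 # replicate r' 2 @ replicate i' 1 @ [0::nat])"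
      by (rule arg_cong)
    then show "i = i'" by (auto dest: arg_cong[where f = length])
  qed
qed simp

lemma enc_zigzag: "((\<lambda>s. Nd (0, 2) [s, enc (BL (letter 0 0))]) ^^ i) (enc (right_comb m)) = enc (zigzag i m)"
  by (induction i) auto

lemma LHI_TWT_hierarchy:
  assumes "k \<ge> 1"
  shows "\<exists>f. f \<in> cpow {g. TWT_fun g \<and> LHI g} k \<and> f \<notin> cpow {g. MTT_fun g} (k - 1)"
proof (intro exI conjI)
  let ?fs = "map (\<lambda>j. twt_fun (dec_twt j)) [0..<k]"
  have "length ?fs = k" "set ?fs \<subseteq> {g. TWT_fun g \<and> LHI g}"
    using wf_dec_twt LHI_dec by (auto simp: TWT_fun_def)
  then have "\<exists>fs. comp_chain ?fs = comp_chain fs \<and> length fs = k \<and> set fs \<subseteq> {g. TWT_fun g \<and> LHI g}"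
    by blast
  then show "comp_chain ?fs \<in> cpow {g. TWT_fun g \<and> LHI g} k"
    using assms by (simp add: cpow_def)
  show "comp_chain ?fs \<notin> cpow {g. MTT_fun g} (k - 1)"
    by (rule dec.not_in_cpow_MTT)
      (use assms in \<open>auto simp: enc_zigzag[simplified] comp_chain_dec[OF leaves_zigzag]\<close>)
qed


section \<open>Hennie machines\<close>

abbreviation rep :: "nat \<Rightarrow> nat list" where
  "rep p \<equiv> replicate p 2"

text \<open>The order matters: later levels come directly behind \<open>x\<close>, so the last stage
  inserts its decorations right after each letter of the string of the earlier stages.\<close>

primrec launch :: "nat \<Rightarrow> nat \<Rightarrow> nat list \<Rightarrow> (nat \<times> nat \<times> dir) tr" where
  "launch x m [] = Nd (x, 0) []"
| "launch x m (l # ls) = Nd (0, 2) [launch x m ls, Lf (2 * l, m, Down 2)]"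

definition marks :: "nat \<Rightarrow> nat set" where
  "marks j = {letter l m | l m. l \<le> j \<and> m < 2 ^ j}"

text \<open>The test \<open>m < 2 ^ (q div 2)\<close> says that only lower levels have written so
  far; adding \<open>2 ^ (q div 2)\<close> then sets a fresh bit. The branch that continues upwards
  keeps the memory unchanged.\<close>

definition hennie_delta :: "nat \<Rightarrow> nat \<Rightarrow> sym \<Rightarrow> nat \<Rightarrow> (nat \<times> nat \<times> dir) tr option" where
  "hennie_delta K q s m =
    (if q \<le> 2 * K + 1 \<and> s \<in> binary {letter 0 0} \<and> m < 2 ^ (K + 1) then
       (if q = 0 then (if s = (0, 2) then Some (launch (letter 0 0) 1 [1..<K + 1]) else None)
        else if even q then Some (if s = (0, 2) then Lf (q, m, Down 2) else Lf (q + 1, m, Up))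
        else if s = (0, 2) \<and> m < 2 ^ (q div 2) then
          (let t = launch (letter (q div 2) m) (m + 2 ^ (q div 2)) [q div 2 + 1..<K + 1]
           in Some (if odd m then t else Nd (0, 2) [t, Lf (q, m, Up)]))
        else None)
     else None)"

text \<open>State 2 * l walks down the right spine to its end, then state 2 * l + 1 walks up, writes
  the mark 2 ^ l on one node in each branch that leaves this walk, and outputs the memory
  content of each node as a letter of level l. The lowest memory bit marks the root.\<close>

definition hennie :: "nat \<Rightarrow> uthm" where
  "hennie K = \<lparr>hQ = {..2 * K + 1}, hM = {..<2 ^ (K + 1)}, htop = 0, hSig = binary {letter 0 0},
     hGam = binary (marks K), hq0 = 0, hdelta = hennie_delta K\<rparr>"

lemma finite_marks: "finite (marks j)"
proof -
  have "marks j = (\<lambda>(l, m). letter l m) ` ({..j} \<times> {..<2 ^ j})" by (auto simp: marks_def)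
  then show ?thesis by simp
qed

lemma wf_launch:
  assumes "x \<in> marks K" "m < 2 ^ (K + 1)" "set ls \<subseteq> {..K}"
  shows "wf (binary (marks K)) {(q', m', d). q' \<in> {..2 * K + 1} \<and> m' \<in> {..<2 ^ (K + 1)} \<and> valid_dir (0, 2) d} (launch x m ls)"
  using assms by (induction ls) (auto simp: binary_def rank_def valid_dir_def)

lemma two_power_less: "m < 2 ^ l \<Longrightarrow> l \<le> K \<Longrightarrow> m < (2 :: nat) ^ K"
  by (meson less_le_trans one_le_numeral power_increasing)

lemma wf_hennie: "wf_uthm (hennie K)"
proof -
  let ?Y = "\<lambda>s. {(q', m', d). q' \<in> {..2 * K + 1} \<and> m' \<in> {..<2 ^ (K + 1)} \<and> valid_dir s d}"
  have delta: "q \<in> {..2 * K + 1} \<and> s \<in> binary {letter 0 0} \<and> m \<in> {..<2 ^ (K + 1)} \<and>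
      wf (binary (marks K)) (?Y s) r" if "hennie_delta K q s m = Some r" for q s m r
  proof -
    have b: "q \<le> 2 * K + 1" "s \<in> binary {letter 0 0}" "m < 2 ^ (K + 1)"
      using that by (auto simp: hennie_delta_def split: if_splits)
    have "wf (binary (marks K)) (?Y s) r"
    proof (cases "q = 0")
      case True
      with that have s: "s = (0, 2)" and r: "r = launch (letter 0 0) 1 [1..<K + 1]"
        by (auto simp: hennie_delta_def split: if_splits)
      have "1 < (2 :: nat) ^ (K + 1)" by (rule one_less_power) auto
      then show ?thesis unfolding s r by (intro wf_launch) (auto simp: marks_def)
    next
      case q: False
      show ?thesis
      proof (cases "even q")
        case True
        with that b q have "r = (if s = (0, 2) then Lf (q, m, Down 2) else Lf (q + 1, m, Up))"
          by (auto simp: hennie_delta_def)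
        moreover have "q + 1 \<le> 2 * K + 1" using True b(1) by presburger
        ultimately show ?thesis using b by (auto simp: valid_dir_def rank_def)
      next
        case False
        define l where "l = q div 2"
        have l: "l \<le> K" using b(1) by (simp add: l_def)
        let ?t = "launch (letter l m) (m + 2 ^ l) [l + 1..<K + 1]"
        from that b q False have s: "s = (0, 2)" "m < 2 ^ l" and r: "r = (if odd m then ?t else Nd (0, 2) [?t, Lf (q, m, Up)])"
          by (auto simp: hennie_delta_def l_def Let_def split: if_splits)
        have "m + 2 ^ l < 2 ^ (K + 1)" using two_power_less[of "m + 2 ^ l" "l + 1" "K + 1"] s(2) l by simp
        then have "wf (binary (marks K)) (?Y (0, 2)) ?t"
          by (intro wf_launch) (use l s(2) two_power_less in \<open>auto simp: marks_def\<close>)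
        then show ?thesis using r s b by (auto simp: binary_def rank_def valid_dir_def)
      qed
    qed
    with b show ?thesis by auto
  qed
  then show ?thesis
    by (auto simp: wf_uthm_def hennie_def ranked_alphabet_def binary_def finite_marks)
qed

subsection \<open>Bounded visits\<close>

text \<open>A strict order along runs: states never decrease, and within one state the depth is
  strictly monotone. Hence a run visits a node at most once per state, which gives the visit bound
  \<open>2 * K + 2\<close>.\<close>

definition progress :: "hconf \<Rightarrow> hconf \<Rightarrow> bool" where
  "progress = (\<lambda>(u, q, _) (u', q', _). q < q' \<or> q = q' \<and>
     (if even q then length u < length u' else length u' < length u))"

lemma transp_progress: "transp progress"
  by (auto simp: transp_def progress_def split: if_splits)

lemma set_launch: "(q, m', d) \<in> set_tr (launch x m ls) \<Longrightarrow> d = Down 2 \<and> (\<exists>l\<in>set ls. q = 2 * l)"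
  by (induction ls) auto

lemma step_progress:
  assumes "thm_step (hennie K) t c = Some r" "c' \<in> set_tr r"
  shows "progress c c'"
proof -
  obtain u q \<mu> where c: "c = (u, q, \<mu>)" by (metis prod_cases3)
  from assms(1) obtain s r' where s: "hennie_delta K q s (\<mu> u) = Some r'"
    and mv: "\<forall>(q', m', d) \<in> set_tr r'. move t u d \<noteq> None"
    and r: "r = map_tr (\<lambda>(q', m', d). (the (move t u d), q', \<mu>(u := m'))) r'"
    by (auto simp: c thm_step_def hennie_def split: option.splits if_splits)
  from assms(2) obtain q' m' d where x: "(q', m', d) \<in> set_tr r'"
    and c': "c' = (the (move t u d), q', \<mu>(u := m'))"
    unfolding r tr.set_map by auto
  obtain u' where u': "move t u d = Some u'" using mv x by auto
  consider "q < q'" | "q' = q" "even q" "d = Down 2" | "q' = q" "odd q" "d = Up"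
  proof (cases "q = 0")
    case True
    with s x have "q < q'" by (auto simp: hennie_delta_def split: if_splits dest!: set_launch)
    with that show thesis by blast
  next
    case q: False
    show thesis
    proof (cases "even q")
      case True
      with s x q that show thesis by (auto simp: hennie_delta_def split: if_splits)
    next
      case False
      have "q < 2 * l" if "l \<in> set [q div 2 + 1..<K + 1]" for l using that False by auto
      with False s x q that show thesis
        by (auto simp: hennie_delta_def Let_def split: if_splits dest!: set_launch)
    qed
  qed
  then show ?thesis
    using u' by cases (auto simp: progress_def c c' move_def split: if_splits)
qed

lemma is_THM_hennie: "is_THM (hennie K)"
  unfolding is_THM_def
proof (intro conjI exI ballI allI impI)
  fix t cs u
  assume run: "branch_run (hennie K) t cs"
  let ?I = "{i. i < length cs \<and> fst (cs ! i) = u}" and ?q = "\<lambda>i. fst (snd (cs ! i))"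
  have "successively progress cs"
    using run step_progress unfolding branch_run_def successively_conv_nth by blast
  then have sorted: "sorted_wrt progress cs"
    by (simp add: successively_conv_sorted_wrt[OF transp_progress])
  have "inj_on ?q ?I"
  proof (rule linorder_inj_onI)
    fix i i' assume i: "i < i'" "i \<in> ?I" "i' \<in> ?I"
    then have "progress (cs ! i) (cs ! i')" using sorted by (auto simp: sorted_wrt_iff_nth_less)
    with i show "?q i \<noteq> ?q i'" by (auto simp: progress_def split: prod.splits if_splits)
  qed auto
  moreover have "?q i \<le> 2 * K + 1" if "i < length cs" for i
  proof (cases i)
    case 0
    have "cs ! 0 = thm_init (hennie K)" using run unfolding branch_run_def by (metis hd_conv_nth)
    with 0 show ?thesis by (simp add: thm_init_def hennie_def)
  next
    case (Suc i')
    with run that obtain r where r: "thm_step (hennie K) t (cs ! i') = Some r" "cs ! i \<in> set_tr r"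
      unfolding branch_run_def by blast
    obtain u q \<mu> where c: "cs ! i' = (u, q, \<mu>)" by (metis prod_cases3)
    from r(1) obtain s r' where s: "hdelta (hennie K) q s (\<mu> u) = Some r'"
      and r': "r = map_tr (\<lambda>(q', m', d). (the (move t u d), q', \<mu>(u := m'))) r'"
      by (auto simp: c thm_step_def split: option.splits if_splits)
    have wf: "wf (hGam (hennie K)) {(q', m', d). q' \<in> hQ (hennie K) \<and> m' \<in> hM (hennie K) \<and> valid_dir s d} r'"
      using wf_hennie[of K] s unfolding wf_uthm_def by blast
    have "set_tr r \<subseteq> Y" if "wf G Y r" for G :: "sym set" and Y and r :: "(nat \<times> nat \<times> dir) tr"
      using that by (induction r) (auto simp: list_all_iff)
    from this[OF wf] r(2) show ?thesis unfolding r' tr.set_map by (auto simp: hennie_def)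
  qed
  ultimately have "card ?I \<le> card {..2 * K + 1}"
    by (intro card_inj_on_le[of ?q]) auto
  then show "card ?I \<le> 2 * K + 2" by simp
qed (rule wf_hennie)

subsection \<open>The output on right combs\<close>

definition mark :: "nat \<Rightarrow> nat \<Rightarrow> (nat list \<Rightarrow> nat) \<Rightarrow> nat list \<Rightarrow> nat" where
  "mark l p \<mu> = \<mu>(rep p := \<mu> (rep p) + 2 ^ l)"

definition pass :: "nat \<Rightarrow> nat \<Rightarrow> (nat list \<Rightarrow> nat) \<Rightarrow> (nat \<times> (nat list \<Rightarrow> nat)) list" where
  "pass n l \<mu> = map (\<lambda>p. (letter l (\<mu> (rep p)), mark l p \<mu>)) (rev [0..<n])"

primrec expand :: "nat \<Rightarrow> nat list \<Rightarrow> nat \<times> (nat list \<Rightarrow> nat) \<Rightarrow> nat list" where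
  "expand n [] it = [fst it]"
| "expand n (l # ls) it = expand n ls it @ concat (map (expand n ls) (pass n l (snd it)))"

text \<open>The invariant before a walk of level \<open>l\<close>. The end leaf \<open>rep n\<close>
  obeys the size bound too, since the walk reads it, but the root test only concerns inner
  nodes.\<close>

definition bounded :: "nat \<Rightarrow> nat \<Rightarrow> (nat list \<Rightarrow> nat) \<Rightarrow> bool" where
  "bounded n l \<mu> \<longleftrightarrow> (\<forall>p\<le>n. \<mu> (rep p) < 2 ^ l) \<and> (\<forall>p<n. odd (\<mu> (rep p)) \<longleftrightarrow> p = 0)"

lemma bounded_mono: "bounded n l \<mu> \<Longrightarrow> l \<le> l' \<Longrightarrow> bounded n l' \<mu>"
  unfolding bounded_def using two_power_less by blast

lemma rep_eq_iff [simp]: "rep p = rep p' \<longleftrightarrow> p = p'"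
  by (metis length_replicate)

lemma bounded_mark:
  assumes "bounded n l \<mu>" "1 \<le> l"
  shows "bounded n (Suc l) (mark l p \<mu>)"
proof -
  have "even ((2 :: nat) ^ l)" using assms(2) by simp
  with assms show ?thesis
    by (auto simp: bounded_def mark_def two_power_less)
qed

lemma node_right_comb: "p \<le> n \<Longrightarrow> node (right_comb n) (rep p) (right_comb (n - p))"
proof (induction p arbitrary: n)
  case (Suc p)
  then show ?case by (cases n) auto
qed simp

lemma yield_map_tr [simp]: "yield (map_tr f s) = yield s"
  by (induction s) (auto simp: o_def cong: map_cong)

context
  fixes K n :: nat
  assumes n: "1 \<le> n"
begin

abbreviation st :: "hconf \<Rightarrow> hconf tr option" where
  "st \<equiv> thm_step (hennie K) (enc (right_comb n))"

abbreviation yields :: "hconf tr \<Rightarrow> nat list \<Rightarrow> bool" where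
  "yields x w \<equiv> \<exists>s. evals st x s \<and> yield s = w"

lemma lab_rep: "p < n \<Longrightarrow> lab (enc (right_comb n) :: nat tr) (rep p) = Some (0, 2)"
  "lab (enc (right_comb n) :: nat tr) (rep n) = Some (letter 0 0, 0)"
proof -
  assume "p < n"
  then obtain m where "n - p = Suc m" by (metis Suc_diff_Suc)
  then show "lab (enc (right_comb n) :: nat tr) (rep p) = Some (0, 2)"
    using node_right_comb[of p n] \<open>p < n\<close>
    by (intro lab_enc(2)[where l = "BL (letter 0 0)" and r = "right_comb m"]) auto
next
  show "lab (enc (right_comb n) :: nat tr) (rep n) = Some (letter 0 0, 0)"
    using node_right_comb[of n n] by (intro lab_enc(1)) auto
qed

lemma rep_Suc: "rep (Suc p) = rep p @ [2]"
  by (simp add: replicate_append_same)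

lemma move_rep:
  "p < n \<Longrightarrow> move (enc (right_comb n) :: nat tr) (rep p) (Down 2) = Some (rep (Suc p))"
  "move (enc (right_comb n) :: nat tr) (rep (Suc p)) Up = Some (rep p)"
  using node_right_comb[of "Suc p" n] unfolding rep_Suc by (auto simp: move_def)

lemma yields_Lf:
  assumes "st c = Some r" "yields r w"
  shows "yields (Lf c) w"
proof -
  from assms(2) obtain s where s: "evals st r s" "yield s = w" by blast
  from evals.Lf[OF assms(1) s(1)] s(2) show ?thesis by blast
qed

lemma yields_Nd2:
  assumes "yields x v" "yields y w"
  shows "yields (Nd g [x, y]) (v @ w)"
proof -
  from assms obtain s s' where s: "evals st x s" "yield s = v" "evals st y s'" "yield s' = w" by blast
  have "evals st (Nd g [x, y]) (Nd g [s, s'])" by (rule evals.Nd) (simp add: s)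
  then show ?thesis by (intro exI[of _ "Nd g [s, s']"]) (simp add: s)
qed

abbreviation conf :: "nat \<Rightarrow> (nat list \<Rightarrow> nat) \<Rightarrow> nat \<times> nat \<times> dir \<Rightarrow> hconf" where
  "conf p \<mu> \<equiv> (\<lambda>(q', m', d). (the (move (enc (right_comb n) :: nat tr) (rep p) d), q', \<mu>(rep p := m')))"

lemma yields_launch:
  assumes run: "\<And>l. l \<in> set ls \<Longrightarrow> yields (Lf (rep (Suc p), 2 * l, \<mu>(rep p := m)))
      (concat (map (expand n [Suc l..<K + 1]) (pass n l (\<mu>(rep p := m)))))"
    and "p < n" "ls = [j..<K + 1]"
  shows "yields (map_tr (conf p \<mu>) (launch x m ls)) (expand n ls (x, \<mu>(rep p := m)))"
  using assms(1,3)
proof (induction ls arbitrary: j)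
  case Nil
  show ?case by (auto intro!: exI[of _ "Nd (x, 0) []"] evals.Nd)
next
  case (Cons l ls)
  then have l: "l = j" "ls = [Suc l..<K + 1]"
    by (cases "j < K + 1"; auto simp: upt_conv_Cons simp del: upt_Suc)+
  have 1: "yields (map_tr (conf p \<mu>) (launch x m ls)) (expand n ls (x, \<mu>(rep p := m)))"
    by (rule Cons.IH) (use Cons.prems(1) l in auto)
  have 2: "yields (Lf (rep (Suc p), 2 * l, \<mu>(rep p := m)))
      (concat (map (expand n ls) (pass n l (\<mu>(rep p := m)))))"
    using Cons.prems(1)[OF list.set_intros(1)] unfolding l(2) .
  from yields_Nd2[OF 1 2, of "(0, 2)"] show ?case
    by (simp add: move_rep(1)[OF assms(2)] del: replicate_Suc fun_upd_apply)
qed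

text \<open>The result is independent of the start \<open>p\<close>, because the walk descends to
  the end of the spine before it prints. Branches launched on the way have higher levels, so
  \<open>K - l\<close> decreases.\<close>

lemma yields_run:
  assumes "1 \<le> l" "l \<le> K" "bounded n l \<mu>" "p \<le> n"
  shows "yields (Lf (rep p, 2 * l, \<mu>)) (concat (map (expand n [Suc l..<K + 1]) (pass n l \<mu>)))"
  using assms
proof (induction "K - l" arbitrary: l \<mu> p rule: less_induct)
  case less
  let ?E = "\<lambda>p. expand n [Suc l..<K + 1] (letter l (\<mu> (rep p)), mark l p \<mu>)"
  have mem: "\<mu> (rep p) < 2 ^ l" "\<mu> (rep p) < 2 ^ (K + 1)" if "p \<le> n" for p
    using less.prems that two_power_less[of "\<mu> (rep p)" l "K + 1"] by (auto simp: bounded_def)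
  let ?t = "\<lambda>p. launch (letter l (\<mu> (rep p))) (\<mu> (rep p) + 2 ^ l) [l + 1..<K + 1]"
  have branch: "yields (map_tr (conf p \<mu>) (?t p)) (?E p)" if "p < n" for p
  proof -
    have "yields (Lf (rep (Suc p), 2 * l', mark l p \<mu>))
        (concat (map (expand n [Suc l'..<K + 1]) (pass n l' (mark l p \<mu>))))"
      if "l' \<in> set [l + 1..<K + 1]" for l'
    proof (rule less.hyps)
      show "bounded n l' (mark l p \<mu>)"
        by (rule bounded_mono[OF bounded_mark[OF less.prems(3,1)]]) (use that in auto)
    qed (use that \<open>p < n\<close> in auto)
    from yields_launch[OF this[unfolded mark_def] that refl] show ?thesis
      by (simp add: mark_def)
  qed
  have step: "st (rep p, 2 * l + 1, \<mu>) = Some (map_tr (conf p \<mu>)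
      (if p = 0 then ?t p else Nd (0, 2) [?t p, Lf (2 * l + 1, \<mu> (rep p), Up)]))" if "p < n" for p
  proof -
    have "hennie_delta K (2 * l + 1) (0, 2) (\<mu> (rep p)) =
        Some (if p = 0 then ?t p else Nd (0, 2) [?t p, Lf (2 * l + 1, \<mu> (rep p), Up)])"
      using less.prems that mem[of p] by (auto simp: hennie_delta_def binary_def bounded_def Let_def)
    moreover have "move (enc (right_comb n) :: nat tr) (rep p) d \<noteq> None"
      if "(q', m', d) \<in> set_tr (?t p) \<or> p \<noteq> 0 \<and> d = Up" for q' m' d
    proof -
      have "p \<noteq> 0 \<Longrightarrow> move (enc (right_comb n) :: nat tr) (rep p) Up \<noteq> None"
        by (cases p) (simp_all add: move_rep(2) del: replicate_Suc)
      with that move_rep(1)[OF \<open>p < n\<close>] show ?thesis by (auto dest: set_launch)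
    qed
    ultimately show ?thesis
      by (auto simp: thm_step_def lab_rep(1)[OF that] hennie_def split: prod.split if_splits)
  qed
  \<comment> \<open>Induction along the upward walk: at \<open>p\<close> it still has to print the
    cells from \<open>p\<close> to the root.\<close>
  have print: "yields (Lf (rep p, 2 * l + 1, \<mu>)) (concat (map ?E (rev [0..<Suc p])))" if "p < n" for p
    using that
  proof (induction p)
    case 0
    show ?case
      by (rule yields_Lf[OF step[OF 0]]) (use branch[OF 0] in simp)
  next
    case (Suc p)
    have "yields (Lf (rep p, 2 * l + 1, \<mu>)) (concat (map ?E (rev [0..<Suc p])))"
      using Suc by simp
    from yields_Nd2[OF branch[OF Suc.prems] this, of "(0, 2)"]
    show ?case
      by (intro yields_Lf[OF step[OF Suc.prems]]) (simp add: move_rep(2) del: replicate_Suc)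
  qed
  from less.prems(4) show ?case
  proof (induction rule: inc_induct)
    case base
    have "st (rep n, 2 * l, \<mu>) = Some (Lf (rep (n - 1), 2 * l + 1, \<mu>))"
      using less.prems(1,2) mem[of n] move_rep(2)[of "n - 1"] n
      by (auto simp: thm_step_def lab_rep(2) hennie_def hennie_delta_def binary_def simp del: replicate_Suc)
    moreover have "yields (Lf (rep (n - 1), 2 * l + 1, \<mu>)) (concat (map ?E (rev [0..<n])))"
      using print[of "n - 1"] n by simp
    ultimately show ?case unfolding pass_def map_map o_def by (rule yields_Lf)
  next
    case (step p)
    have "st (rep p, 2 * l, \<mu>) = Some (Lf (rep (Suc p), 2 * l, \<mu>))"
      using less.prems(1,2) mem[of p] move_rep(1)[OF step(2)] step(2)
      by (auto simp: thm_step_def lab_rep(1) hennie_def hennie_delta_def binary_def simp del: replicate_Suc)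
    then show ?case using step.IH by (rule yields_Lf)
  qed
qed

lemma hennie_output:
  "\<exists>s. uthm_fun (hennie K) (enc (right_comb n)) = Some s \<and>
    yield s = expand n [1..<K + 1] (letter 0 0, (\<lambda>_. 0)([] := 1))"
proof -
  have n0: "0 < n" using n by simp
  have "bounded n 1 ((\<lambda>_. 0)([] := 1))" by (auto simp: bounded_def)
  then have run: "yields (Lf (rep (Suc 0), 2 * l, (\<lambda>_. 0)(rep 0 := 1)))
      (concat (map (expand n [Suc l..<K + 1]) (pass n l ((\<lambda>_. 0)(rep 0 := 1)))))" if "l \<in> set [1..<K + 1]" for l
    using that n bounded_mono by (intro yields_run) auto
  have "st ([], 0, \<lambda>_. 0) = Some (map_tr (conf 0 (\<lambda>_. 0)) (launch (letter 0 0) 1 [1..<K + 1]))"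
    using lab_rep(1)[OF n0] move_rep(1)[OF n0]
    by (auto simp: thm_step_def hennie_def hennie_delta_def binary_def split: prod.split dest!: set_launch)
  then have "yields (Lf ([], 0, \<lambda>_. 0)) (expand n [1..<K + 1] (letter 0 0, (\<lambda>_. 0)([] := 1)))"
    by (rule yields_Lf) (use yields_launch[OF run n0 refl] in simp)
  then obtain s where s: "evals st (Lf ([], 0, \<lambda>_. 0)) s"
    "yield s = expand n [1..<K + 1] (letter 0 0, (\<lambda>_. 0)([] := 1))" by blast
  have "leaves (right_comb n) \<subseteq> {letter 0 0}" by (induction n) auto
  then have "enc (right_comb n) \<in> T (hSig (hennie K))" by (auto simp: hennie_def in_T_binary_iff)
  with rw_output_evals[OF s(1)] s(2) show ?thesis
    by (simp add: uthm_fun_def thm_init_def hennie_def)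
qed

end

subsection \<open>The output strings as a hard family\<close>

primrec items :: "nat \<Rightarrow> nat \<Rightarrow> (nat \<times> (nat list \<Rightarrow> nat)) list" where
  "items n 0 = [(letter 0 0, (\<lambda>_. 0)([] := 1))]"
| "items n (Suc l) = concat (map (\<lambda>it. it # pass n (Suc l) (snd it)) (items n l))"

text \<open>\<open>expand\<close> follows the branching of the machine, \<open>items\<close> inserts
  one level at a time behind all existing items. Performing the next level on the whole list shows
  that both give the same string.\<close>

lemma expand_items:
  "concat (map (expand n [Suc l..<Suc l + d]) (items n l)) = map fst (items n (l + d))"
proof (induction d arbitrary: l)
  case 0
  have "concat (map (expand n []) its) = map fst its" for its by (induction its) auto
  then show ?case by simp
next
  case (Suc d)
  have "concat (map (expand n (Suc l # ls)) its) =
      concat (map (expand n ls) (concat (map (\<lambda>it. it # pass n (Suc l) (snd it)) its)))" for ls its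
    by (induction its) auto
  moreover have "[Suc l..<Suc l + Suc d] = Suc l # [Suc (Suc l)..<Suc (Suc l) + d]" by (simp add: upt_conv_Cons)
  ultimately have "concat (map (expand n [Suc l..<Suc l + Suc d]) (items n l)) =
      concat (map (expand n [Suc (Suc l)..<Suc (Suc l) + d]) (items n (Suc l)))"
    by (simp only: items.simps)
  then show ?case using Suc[of "Suc l"] by simp
qed

definition tape :: "nat \<Rightarrow> (nat list \<Rightarrow> nat) \<Rightarrow> nat list" where
  "tape n \<mu> = map (\<lambda>p. \<mu> (rep p)) (rev [0..<n])"

lemma tape_eq_iff: "tape n \<mu> = tape n \<mu>' \<longleftrightarrow> (\<forall>p<n. \<mu> (rep p) = \<mu>' (rep p))"
  by (auto simp: tape_def)

definition marked_items :: "nat \<Rightarrow> nat \<Rightarrow> (nat \<times> nat list) list" where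
  "marked_items n l = map (\<lambda>(x, \<mu>). (x, map (letter (Suc l)) (tape n \<mu>))) (items n l)"

lemma decorate_marked_items: "map fst (items n (Suc l)) = decorate (marked_items n l)"
proof -
  have "map fst (concat (map (\<lambda>it. it # pass n (Suc l) (snd it)) its)) =
      decorate (map (\<lambda>(x, \<mu>). (x, map (letter (Suc l)) (tape n \<mu>))) its)" for its
    by (induction its) (auto simp: decorate_def pass_def tape_def)
  then show ?thesis by (simp add: marked_items_def)
qed

lemma items_bounded: "(x, \<mu>) \<in> set (items n l) \<Longrightarrow> x \<in> marks l \<and> bounded n (Suc l) \<mu>"
proof (induction l arbitrary: x \<mu>)
  case 0
  then show ?case by (auto simp: marks_def bounded_def)
next
  case (Suc l)
  then obtain y \<nu> where it: "(y, \<nu>) \<in> set (items n l)" "(x, \<mu>) = (y, \<nu>) \<or> (x, \<mu>) \<in> set (pass n (Suc l) \<nu>)"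
    by auto
  from Suc.IH[OF it(1)] have y: "y \<in> marks l" "bounded n (Suc l) \<nu>" by auto
  have "marks l \<subseteq> marks (Suc l)" by (force simp: marks_def)
  from it(2) show ?case
  proof
    assume "(x, \<mu>) = (y, \<nu>)"
    then show ?thesis using y \<open>marks l \<subseteq> _\<close> bounded_mono[OF y(2), of "Suc (Suc l)"] by auto
  next
    assume "(x, \<mu>) \<in> set (pass n (Suc l) \<nu>)"
    then obtain p where p: "p < n" "x = letter (Suc l) (\<nu> (rep p))" "\<mu> = mark (Suc l) p \<nu>" by (auto simp: pass_def)
    with y(2) bounded_mark[OF y(2)] show ?thesis by (auto simp: marks_def bounded_def)
  qed
qed

text \<open>\<open>r\<close> recovers the key of a block from each of its entries, so entries of
  different blocks cannot collide.\<close>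

lemma distinct_concat_key:
  assumes "distinct (map key xs)"
    and "\<And>x y. x \<in> set xs \<Longrightarrow> y \<in> set (f x) \<Longrightarrow> r (g y) = key x"
    and "\<And>x. x \<in> set xs \<Longrightarrow> distinct (map g (f x))"
  shows "distinct (map g (concat (map f xs)))"
  using assms
proof (induction xs)
  case (Cons x xs)
  have "g y \<noteq> g y'" if "y \<in> set (f x)" "x' \<in> set xs" "y' \<in> set (f x')" for y x' y'
  proof
    assume "g y = g y'"
    with Cons.prems(2)[of x y] Cons.prems(2)[of x' y'] that have "key x = key x'" by simp
    with Cons.prems(1) that(2) show False by auto
  qed
  with Cons show ?case by (auto simp: map_concat)
qed simp

text \<open>The marks written at stage l + 1 are removed by taking remainders modulo 2 ^ (l + 1),
  so the tape identifies the choices made at all stages.\<close>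

lemma distinct_tapes: "distinct (map (\<lambda>it. tape n (snd it)) (items n l))"
proof (induction l)
  case (Suc l)
  let ?N = "2 ^ Suc l :: nat"
  show ?case unfolding items.simps
  proof (rule distinct_concat_key[where r = "map (\<lambda>v. v mod ?N)", OF Suc])
    fix it it' assume it: "it \<in> set (items n l)" "it' \<in> set (it # pass n (Suc l) (snd it))"
    from it(1) items_bounded[of "fst it" "snd it" n l] have b: "\<mu> < ?N" if "p < n" "\<mu> = snd it (rep p)" for p \<mu>
      using that by (auto simp: bounded_def)
    show "map (\<lambda>v. v mod ?N) (tape n (snd it')) = tape n (snd it)"
      using it(2) b by (auto simp: pass_def tape_def mark_def simp del: power_Suc)
  next
    fix it assume "it \<in> set (items n l)"
    have "inj_on (\<lambda>p. tape n (mark (Suc l) p (snd it))) {0..<n}"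
    proof (rule inj_onI)
      fix p p' assume p: "p \<in> {0..<n}" and "tape n (mark (Suc l) p (snd it)) = tape n (mark (Suc l) p' (snd it))"
      then have "mark (Suc l) p (snd it) (rep p) = mark (Suc l) p' (snd it) (rep p)" by (simp add: tape_eq_iff)
      then show "p = p'" by (auto simp: mark_def split: if_splits)
    qed
    moreover have "\<forall>p\<in>{0..<n}. tape n (snd it) \<noteq> tape n (mark (Suc l) p (snd it))"
      by (auto simp: tape_eq_iff mark_def)
    ultimately show "distinct (map (\<lambda>it. tape n (snd it)) (it # pass n (Suc l) (snd it)))"
      by (auto simp: pass_def distinct_map o_def)
  qed
qed simp

text \<open>The index is shifted by one: \<open>items n 0\<close> is a single item, so level 1 makes
  the string long and level 2 is the first useful decoration.\<close>

interpretation hennie: hard_family "\<lambda>s. Nd (0, 2) [enc (BL (letter 0 0)), s]" "(0, 2)" "[enc (BL (letter 0 0))]" "[]"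
  "\<lambda>m. enc (right_comb (Suc m))" "\<lambda>j. marks (Suc j)" "\<lambda>j i m. map fst (items (Suc (i + m)) (Suc j))"
proof
  fix j i m I
  have dec: "decorated (marks l) (marked_items n l)" for l n
    by unfold_locales (auto simp: marked_items_def marks_def dest: items_bounded)
  show "finite (marks (Suc j))" by (rule finite_marks)
  show "filter (\<lambda>x. x \<in> marks (Suc (Suc j))) (map fst (items (Suc (i + m)) (Suc (Suc (Suc j))))) =
     map fst (items (Suc (i + m)) (Suc (Suc j)))"
    unfolding decorate_marked_items[of _ "Suc (Suc j)"] filter_decorate[OF dec]
    by (simp add: marked_items_def case_prod_unfold o_def)
  show "\<not> dup (marks (Suc (Suc j))) (map fst (items (Suc (i + m)) (Suc (Suc (Suc j)))))"
    unfolding decorate_marked_items[of _ "Suc (Suc j)"]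
  proof (rule decorate_not_dup[OF dec])
    have "map snd (marked_items n l) = map (map (letter (Suc l))) (map (\<lambda>it. tape n (snd it)) (items n l))" for n l
      by (auto simp: marked_items_def)
    moreover have "inj (map (letter l))" for l by (simp add: inj_on_def)
    ultimately show "distinct (map snd (marked_items (Suc (i + m)) (Suc (Suc j))))"
      using distinct_tapes
      by (simp only: distinct_map[of _ "map (\<lambda>it. tape _ (snd it)) _"] inj_on_subset[OF _ subset_UNIV])
  qed
  show "m \<le> cnt (marks (Suc 0)) (map fst (items (Suc (i + m)) (Suc (Suc 0))))"
    unfolding decorate_marked_items[of _ "Suc 0"] cnt_decorate[OF dec]
    by (simp add: marked_items_def pass_def)
  show "\<exists>N. \<forall>i\<le>I. \<forall>i'\<le>I. \<forall>m u. sublist u (map fst (items (Suc (i + m)) (Suc (Suc 0)))) \<longrightarrow>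
      sublist u (map fst (items (Suc (i' + m)) (Suc (Suc 0)))) \<longrightarrow> cnt (marks (Suc 0)) u > N \<longrightarrow> i = i'"
    unfolding decorate_marked_items[of _ "Suc 0"]
  \<comment> \<open>Two letters suffice: the complete decoration between them is a tape, and its
    length \<open>Suc (i + m)\<close> reveals \<open>i\<close>.\<close>
  proof (intro exI[of _ 1] allI impI)
    fix i i' m u
    assume u: "sublist u (decorate (marked_items (Suc (i + m)) (Suc 0)))"
      "sublist u (decorate (marked_items (Suc (i' + m)) (Suc 0)))" "cnt (marks (Suc 0)) u > 1"
    obtain u1 a d a' u2 where ud: "u = u1 @ a # d @ a' # u2" "cnt (marks (Suc 0)) u1 = 0"
      "cnt (marks (Suc 0)) d = 0" "a \<in> marks (Suc 0)" "a' \<in> marks (Suc 0)"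
      by (rule first_two_letters[of "marks (Suc 0)" u]) (use u(3) in auto)
    have "length d = n" if sub: "sublist u (decorate (marked_items n (Suc 0)))" for n
    proof -
      obtain r where r: "r + cnt (marks (Suc 0)) u \<le> length (marked_items n (Suc 0))" "marked_items n (Suc 0) ! r = (a, d)"
        using decorate_sublist_item[OF dec sub ud] by blast
      then have "(a, d) \<in> set (marked_items n (Suc 0))" using u(3) nth_mem[of r "marked_items n (Suc 0)"] by simp
      then show ?thesis by (auto simp: marked_items_def tape_def)
    qed
    from this[OF u(1)] this[OF u(2)] show "i = i'" by simp
  qed
qed simp

lemma enc_right_comb:
  "((\<lambda>s. Nd (0, 2) [enc (BL (letter 0 0)), s]) ^^ i) (enc (right_comb (Suc m))) = enc (right_comb (Suc (i + m)))"
  by (induction i) auto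

lemma THM_hierarchy: "\<exists>f. THM_fun f \<and> f \<notin> cpow {g. MTT_fun g} j"
proof (intro exI conjI)
  \<comment> \<open>One level produces the long string, one decoration survives all erasures, and
    \<open>j\<close> levels are erased.\<close>
  let ?K = "Suc (Suc j)"
  show "THM_fun (uthm_fun (hennie ?K))" using is_THM_hennie unfolding THM_fun_def by blast
  have "expand n [1..<?K + 1] (letter 0 0, (\<lambda>_. 0)([] := 1)) = map fst (items n ?K)" for n
    using expand_items[of n 0 ?K] by simp
  then have "\<exists>s. uthm_fun (hennie ?K) (enc (right_comb (Suc n))) = Some s \<and> yield s = map fst (items (Suc n) ?K)" for n
    using hennie_output[of "Suc n" ?K] by simp
  then show "uthm_fun (hennie ?K) \<notin> cpow {g. MTT_fun g} j"
    by (intro hennie.not_in_cpow_MTT) (simp only: enc_right_comb)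
qed

theorem mainTheorem8:
  fixes k :: nat
  assumes "k \<ge> 1"
  shows "(\<exists>f. f \<in> cpow {g. TWT_fun g \<and> LHI g} k \<and> f \<notin> cpow {g. MTT_fun g} (k - 1))
       \<and> (\<exists>f. THM_fun f \<and> f \<notin> cpow {g. MTT_fun g} (k - 1))"
  using LHI_TWT_hierarchy[OF assms] THM_hierarchy by blast

end
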